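(* For any integers $r$ and $t\ge 1$, there are infinitely many integers $N\equiv r\pmod{t}$ for which $\frac{\overline{c\phi_2}(N)}{4}$ is even.
   Context: Let $c\phi_2(n)$ be defined by $\sum_{n\ge0}c\phi_2(n)q^n=\prod_{n\ge1}\frac{1-q^{4n-2}}{(1-q^{2n-1})^4(1-q^{4n})}$, and let $p(n)$ be the partition function, with the convention $p(x)=0$ if $x$ is not a nonnegative integer. Define $\overline{c\phi_2}(n):=c\phi_2(n)-p(n/2)$; this is always divisible by $4$ (equivalently, $\sum_{n\ge0}\overline{c\phi_2}(n)q^n=4q\prod_{n\ge1}\frac{(1-q^{16n})^2}{(1-q^n)^2(1-q^{8n})}$). *)

theory Defs
  imports "HOL-Analysis.Analysis" "HOL-Library.Multiset" "HOL-Number_Theory.Cong"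
begin

definition partition_number :: "nat \<Rightarrow> nat" where
  "partition_number n = card {M :: nat multiset. 0 \<notin># M \<and> \<Sum>\<^sub># M = n}"

definition cphi2_factor :: "nat \<Rightarrow> real fps" where
  "cphi2_factor n =
     (1 - fps_X ^ (4 * n - 2)) / ((1 - fps_X ^ (2 * n - 1)) ^ 4 * (1 - fps_X ^ (4 * n)))"

text \<open>
  The infinite product is the limit of the finite products in the topology of formal power
  series. It is indexed from 0, so the usual index \<open>n \<ge> 1\<close> is \<open>Suc i\<close>. Real coefficients
  are used so that the factors can be divided; the coefficients of the product are integers.
\<close>

definition cphi2_gf :: "real fps" where
  "cphi2_gf = (\<Prod>i. cphi2_factor (Suc i))"

definition cphi2 :: "nat \<Rightarrow> real" where
  "cphi2 n = fps_nth cphi2_gf n"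

definition cphi2_bar :: "nat \<Rightarrow> real" where
  "cphi2_bar n = cphi2 n - (if even n then of_nat (partition_number (n div 2)) else 0)"

lemma cphi2_factor_minus_1:
  "\<exists>D. fps_nth D 0 = 4 \<and> cphi2_factor (Suc k) - 1 = fps_X ^ (2 * k + 1) * D"
proof -
  define m where "m = 2 * k + 1"
  define x :: "real fps" where "x = fps_X ^ m"
  define y :: "real fps" where "y = fps_X ^ 3 * fps_X ^ (2 * k)"
  define B where "B = (1 - x) ^ 4 * (1 - x * y)"
  have m: "m > 0" by (simp add: m_def)
  have x0: "fps_nth x 0 = 0" using m by (simp add: x_def)
  have y0: "fps_nth y 0 = 0" by (simp add: y_def fps_mult_nth_0)
  have B0: "fps_nth B 0 = 1" by (simp add: B_def x0 fps_mult_nth_0 fps_nth_power_0)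
  have e1: "fps_X ^ (4 * Suc k - 2) = x * x"
    by (simp add: x_def m_def flip: power_add)
  have e2: "fps_X ^ (2 * Suc k - 1) = x"
    by (simp add: x_def m_def)
  have e3: "fps_X ^ (4 * Suc k) = x * y"
    unfolding x_def y_def m_def power_add[symmetric] by (rule arg_cong[where f = "power fps_X"]) simp
  have f: "cphi2_factor (Suc k) = (1 - x * x) * inverse B"
    unfolding cphi2_factor_def e1 e2 e3 B_def[symmetric] by (rule fps_divide_unit) (simp add: B0)
  have "B * inverse B = 1"
    using B0 by (metis inverse_mult_eq_1' zero_neq_one)
  hence "cphi2_factor (Suc k) - 1 = (1 - x * x - B) * inverse B"
    unfolding f by (simp add: algebra_simps)
  also have "1 - x * x - B = x * (4 - 7 * x + 4 * x ^ 2 - x ^ 3 + (1 - x) ^ 4 * y)"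
    unfolding B_def by algebra
  finally have eq: "cphi2_factor (Suc k) - 1 =
      x * ((4 - 7 * x + 4 * x ^ 2 - x ^ 3 + (1 - x) ^ 4 * y) * inverse B)"
    by (simp add: mult.assoc)
  have "fps_nth ((4 - 7 * x + 4 * x ^ 2 - x ^ 3 + (1 - x) ^ 4 * y) * inverse B) 0 = 4"
    by (simp add: fps_mult_nth_0 x0 y0 B0 fps_nth_power_0)
  with eq show ?thesis unfolding x_def m_def by blast
qed

lemma cphi2_has_prod: "(\<lambda>i. cphi2_factor (Suc i)) has_prod cphi2_gf"
proof -
  let ?f = "\<lambda>i. cphi2_factor (Suc i)"
  have sub: "subdegree (?f k - 1) = 2 * k + 1" for k
  proof -
    obtain D where D: "fps_nth D 0 = 4" "?f k - 1 = fps_X ^ (2 * k + 1) * D"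
      using cphi2_factor_minus_1 by blast
    then have "D \<noteq> 0" by auto
    have "subdegree (fps_X ^ (2 * k + 1) * D) = subdegree (fps_X ^ (2 * k + 1) :: real fps) + subdegree D"
      by (rule subdegree_mult) (use \<open>D \<noteq> 0\<close> in auto)
    with D show ?thesis by (simp add: subdegree_eq_0)
  qed
  have f0: "fps_nth (?f k) 0 = 1" for k
  proof -
    have "fps_nth (?f k - 1) 0 = 0"
      by (rule nth_less_subdegree_zero) (unfold sub, simp)
    then show ?thesis by simp
  qed
  have nz: "?f k \<noteq> 0" for k
    using f0[of k] by auto
  obtain P where P: "(\<lambda>n. \<Prod>k\<le>n. ?f k) \<longlonglongrightarrow> P"
    using tendsto_prod_fps[of ?f "\<lambda>n. n"] nz sub by force
  have "\<forall>\<^sub>F n in sequentially. fps_nth (\<Prod>k\<le>n. ?f k) 0 = fps_nth P 0"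
    using P unfolding tendsto_fps_iff by blast
  moreover have "fps_nth (\<Prod>k\<le>n. ?f k) 0 = 1" for n
    by (induction n) (simp_all add: f0 fps_mult_nth_0)
  ultimately have "fps_nth P 0 = 1" by simp
  then have "P \<noteq> 0" by auto
  with P have "?f has_prod P"
    by (simp add: has_prod_def raw_has_prod_def)
  then show ?thesis
    unfolding cphi2_gf_def using has_prod_unique by metis
qed

end

theory Submission
  imports Defs "HOL-Library.Z2"
begin

text \<open>
  Write \<open>f\<^sub>k\<close> for the product of all \<open>1 - q^(k n)\<close> with \<open>n \<ge> 1\<close>. The generating function of
  \<open>c\<phi>\<^sub>2\<close> is \<open>\<phi>(q) / f\<^sub>1\<^sup>2\<close> and the one of \<open>p(n/2)\<close> is \<open>1 / f\<^sub>2 = \<phi>(-q) / f\<^sub>1\<^sup>2\<close>, where \<open>\<phi>(q)\<close> is the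
  sum of \<open>q^(j\<^sup>2)\<close> over all integers \<open>j\<close>. In the difference only odd squares survive, each with
  coefficient 4. Modulo 2, the quotient by 4 is congruent to \<open>q f\<^sub>2\<^sup>1\<^sup>1\<close>, which is \<open>q f\<^sub>2\<^sup>3\<close> times \<open>f\<^sub>1\<^sub>6\<close>;
  by the Jacobi triple product both factors are theta series, so an odd coefficient at \<open>N\<close> forces
  \<open>12 N - 1 = 3 x\<^sup>2 + 8 y\<^sup>2\<close>. This is impossible if a prime \<open>p\<close> that is inert in the field of
  \<open>sqrt (-6)\<close> divides \<open>12 N - 1\<close> exactly once. Such a \<open>p\<close>, coprime to \<open>t\<close>, divides \<open>24 t - 1\<close>, and the
  Chinese remainder theorem yields infinitely many such \<open>N\<close> congruent to \<open>r\<close>.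
\<close>

section \<open>Primes inert in the field of the square root of -6\<close>

text \<open>The residues 1, 5, 7, 11 form a subgroup of the units modulo 24: they are the classes of
  the primes \<open>p > 3\<close> modulo which -6 is a square. Only closure under multiplication is
  used here.\<close>

lemma mod_24_of_prime_divisors:
  fixes n :: nat
  assumes "n > 0" "\<And>q. prime q \<Longrightarrow> q dvd n \<Longrightarrow> q mod 24 \<in> {1, 5, 7, 11}"
  shows "n mod 24 \<in> {1, 5, 7, 11}"
  using assms
proof (induction n rule: less_induct)
  case (less n)
  show ?case
  proof (cases "n = 1")
    case False
    then obtain q where q: "prime q" "q dvd n"
      using prime_factor_nat by blast
    then obtain m where m: "n = q * m" by (auto elim: dvdE)
    have "m > 0" using less.prems(1) m by (cases m) auto
    moreover have "m < n" using m \<open>m > 0\<close> prime_gt_1_nat[OF q(1)] by simp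
    moreover have "r mod 24 \<in> {1, 5, 7, 11}" if "prime r" "r dvd m" for r
      using less.prems(2)[of r] that m by auto
    ultimately have "m mod 24 \<in> {1, 5, 7, 11}"
      using less.IH by blast
    moreover have "q mod 24 \<in> {1, 5, 7, 11}" using less.prems(2) q by blast
    moreover have "n mod 24 = (q mod 24) * (m mod 24) mod 24"
      unfolding m by (simp add: mod_mult_eq)
    ultimately show ?thesis by auto
  qed auto
qed

lemma odd_square_mod_8:
  fixes x :: nat
  assumes "odd x"
  shows "x\<^sup>2 mod 8 = 1"
proof -
  have "x mod 8 = 1 \<or> x mod 8 = 3 \<or> x mod 8 = 5 \<or> x mod 8 = 7"
    using assms by presburger
  moreover have "x\<^sup>2 mod 8 = (x mod 8)\<^sup>2 mod 8" by (simp add: power_mod)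
  ultimately show ?thesis by auto
qed

text \<open>These are the cofactors met in the descent: \<open>w^2 + 6\<close>, and
  \<open>(u^2 + 6) / 3\<close> for \<open>u = 3 * w\<close>.\<close>

lemma odd_square_add_6_mod_24:
  fixes w :: nat
  assumes "odd w"
  shows "\<not> 3 dvd w \<Longrightarrow> (w\<^sup>2 + 6) mod 24 = 7" "(3 * w\<^sup>2 + 2) mod 24 = 5"
proof -
  have 8: "w\<^sup>2 mod 8 = 1" using odd_square_mod_8[OF assms] .
  have *: "(3 * s + 2) mod 24 = 5" "s mod 3 = 1 \<Longrightarrow> (s + 6) mod 24 = 7" if s: "s mod 8 = 1" for s :: nat
  proof -
    obtain a where a: "s = 8 * a + 1" using div_mult_mod_eq[of s 8] s by (metis mult.commute)
    then have "3 * s + 2 = 5 + 24 * a" by simp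
    then show "(3 * s + 2) mod 24 = 5" by simp
    assume "s mod 3 = 1"
    then obtain b where b: "s = 3 * b + 1" using div_mult_mod_eq[of s 3] by (metis mult.commute)
    \<comment> \<open>This is \<open>s = 9 * s - 8 * s\<close>, with \<open>9 * s\<close> expanded
      by \<open>a\<close> and \<open>8 * s\<close> by \<open>b\<close>, rearranged to avoid
      subtraction.\<close>
    have "s + 24 * (b + 1) = 25 + 24 * (3 * a)" using a b by simp
    then have "s mod 24 = (25 + 24 * (3 * a)) mod 24" by (metis mod_mult_self2)
    also have "\<dots> = 1" by (subst mod_mult_self2) simp
    finally show "(s + 6) mod 24 = 7" using mod_add_left_eq[of s 24 6] by simp
  qed
  show "(3 * w\<^sup>2 + 2) mod 24 = 5" using * 8 by blast
  assume "\<not> 3 dvd w"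
  then have "w mod 3 = 1 \<or> w mod 3 = 2" by presburger
  moreover have "w\<^sup>2 mod 3 = (w mod 3)\<^sup>2 mod 3" by (simp add: power_mod)
  ultimately have "w\<^sup>2 mod 3 = 1" by auto
  with 8 * show "(w\<^sup>2 + 6) mod 24 = 7" by blast
qed

text \<open>
  Descent: \<open>w\<close> may be taken odd and less than \<open>p\<close>, so that the cofactor of \<open>p\<close> in \<open>w\<^sup>2 + 6\<close> is
  less than \<open>p\<close>, and its prime divisors are covered by the induction hypothesis.
\<close>

lemma prime_dvd_square_add_6:
  fixes p w :: nat
  assumes "prime p" "p > 3" "p dvd w\<^sup>2 + 6"
  shows "p mod 24 \<in> {1, 5, 7, 11}"
  using assms
proof (induction p arbitrary: w rule: less_induct)
  case (less p)
  have "odd p" using less.prems prime_odd_nat by auto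
  \<comment> \<open>Since \<open>p\<close> is odd, \<open>w mod p\<close> and
    \<open>p - w mod p\<close> have opposite parity.\<close>
  define u where "u = (if odd (w mod p) then w mod p else p - w mod p)"
  have "w mod p < p" using less.prems by simp
  have "p dvd (w mod p)\<^sup>2 + 6"
  proof -
    have "((w mod p)\<^sup>2 + 6) mod p = (w\<^sup>2 + 6) mod p" by (metis mod_add_left_eq power_mod)
    then show ?thesis using less.prems(3) by (simp add: dvd_eq_mod_eq_0)
  qed
  have "p dvd u\<^sup>2 + 6"
  proof (cases "odd (w mod p)")
    case False
    have "int (u\<^sup>2 + 6) = int ((w mod p)\<^sup>2 + 6) + int p * (int p - 2 * int (w mod p))"
    proof -
      have u: "int u = int p - int (w mod p)" using False \<open>w mod p < p\<close> by (simp add: u_def of_nat_diff)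
      have "(int p - v)\<^sup>2 + 6 = v\<^sup>2 + 6 + int p * (int p - 2 * v)" for v
        by (simp add: power2_eq_square algebra_simps)
      then show ?thesis by (simp only: of_nat_add of_nat_power of_nat_numeral u)
    qed
    then have "int p dvd int (u\<^sup>2 + 6)"
      using \<open>p dvd (w mod p)\<^sup>2 + 6\<close> by (metis dvd_add dvd_triv_left int_dvd_int_iff)
    then show ?thesis by (simp only: int_dvd_int_iff)
  qed (use \<open>p dvd (w mod p)\<^sup>2 + 6\<close> in \<open>simp add: u_def\<close>)
  have "odd u"
  proof (cases "odd (w mod p)")
    case False
    then show ?thesis using \<open>odd p\<close> \<open>w mod p < p\<close> even_diff_nat[of p "w mod p"] by (simp add: u_def)
  qed (simp add: u_def)
  have "u < p"
  proof (cases "odd (w mod p)")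
    case False
    have "w mod p \<noteq> 0"
    proof
      assume "w mod p = 0"
      then have "p dvd 6" using \<open>p dvd (w mod p)\<^sup>2 + 6\<close> by simp
      then have "p \<le> 6" by (rule dvd_imp_le) simp
      then have "p \<in> {4, 5, 6}" using less.prems(2) by auto
      then show False
      proof (elim insertE emptyE)
        assume "p = 5"
        then show False using \<open>p dvd 6\<close> by simp
      qed (use \<open>odd p\<close> in simp_all)
    qed
    then have "p - w mod p < p" using less.prems(2) by (intro diff_less) auto
    then show ?thesis using False unfolding u_def by simp
  next
    case True
    then show ?thesis using \<open>w mod p < p\<close> unfolding u_def by simp
  qed
  \<comment> \<open>A possible factor 3 is split off, so that the remaining \<open>n\<close> is
    coprime to 6 and its class modulo 24 is known.\<close>
  have "\<exists>n e. u\<^sup>2 + 6 = e * n \<and> (e = 1 \<or> e = 3) \<and> (n mod 24 = 7 \<or> n mod 24 = 5)"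
  proof (cases "3 dvd u")
    case True
    then obtain v where v: "u = 3 * v" by (auto elim: dvdE)
    then have "odd v" using \<open>odd u\<close> by auto
    then show ?thesis
      using odd_square_add_6_mod_24(2)[OF \<open>odd v\<close>] v
      by (intro exI[of _ "3 * v\<^sup>2 + 2"] exI[of _ 3]) (simp add: power2_eq_square)
  next
    case False
    then show ?thesis
      using odd_square_add_6_mod_24(1)[OF \<open>odd u\<close>]
      by (intro exI[of _ "u\<^sup>2 + 6"] exI[of _ 1]) simp
  qed
  then obtain n e where ne: "u\<^sup>2 + 6 = e * n" "e = 1 \<or> e = 3" "n mod 24 = 7 \<or> n mod 24 = 5"
    by blast
  have "\<not> p dvd e" using ne(2) less.prems(2) by (auto dest: dvd_imp_le)
  then have "p dvd n"
    using \<open>p dvd u\<^sup>2 + 6\<close> ne(1) less.prems(1) prime_dvd_mult_nat by metis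
  then obtain m where m: "n = p * m" by (auto elim: dvdE)
  have "n > 0" using ne(3) by (cases n) auto
  then have "m > 0" using m by (cases m) auto
  have "m mod 24 \<in> {1, 5, 7, 11}"
  proof (rule mod_24_of_prime_divisors[OF \<open>m > 0\<close>])
    fix q assume q: "prime q" "q dvd m"
    then have "q dvd n" using m by simp
    have "n mod 2 = 1" "n mod 3 \<noteq> 0"
      using ne(3) mod_mod_cancel[of 2 24 n] mod_mod_cancel[of 3 24 n] by auto
    then have "q \<noteq> 2" "q \<noteq> 3" using \<open>q dvd n\<close> by auto
    then have "q > 3" using prime_ge_2_nat[OF q(1)] by linarith
    moreover have "q dvd u\<^sup>2 + 6" using \<open>q dvd n\<close> ne(1) by simp
    moreover have "q < p"
    proof -
      \<comment> \<open>Being both odd, \<open>u\<close> and \<open>p\<close> differ by at least 2.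
        This gap gives \<open>u^2 + 6 < p^2\<close>, hence \<open>m < p\<close>.\<close>
      have "Suc u \<noteq> p" using \<open>odd u\<close> \<open>odd p\<close> by auto
      then have "u \<le> p - 2" using \<open>u < p\<close> by linarith
      then have "u * u \<le> (p - 2) * (p - 2)" by (intro mult_mono) auto
      moreover have "(p - 2) * (p - 2) + 6 < p * p"
      proof -
        obtain k where "p = k + 4" using less.prems(2) le_Suc_ex[of 4 p] by auto
        then show ?thesis by (simp add: algebra_simps)
      qed
      ultimately have "u\<^sup>2 + 6 < p * p" by (simp add: power2_eq_square)
      moreover have "p * m \<le> u\<^sup>2 + 6" using ne m by auto
      ultimately have "p * m < p * p" by linarith
      then have "m < p" by simp
      then show ?thesis using dvd_imp_le[OF q(2) \<open>m > 0\<close>] by simp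
    qed
    ultimately show "q mod 24 \<in> {1, 5, 7, 11}" using less.IH q(1) by blast
  qed
  \<comment> \<open>Every unit modulo 24 is its own inverse, so \<open>p\<close> is congruent to
    \<open>n * m\<close>, a product of two elements of the subgroup.\<close>
  then have "(m mod 24) * (m mod 24) mod 24 = 1" by auto
  then have "m * m mod 24 = 1" by (simp add: mod_mult_eq)
  then have "p mod 24 = p * (m * m) mod 24" by (metis mod_mult_right_eq mult_1_right)
  also have "p * (m * m) = n * m" unfolding m by simp
  also have "n * m mod 24 = (n mod 24) * (m mod 24) mod 24" by (simp add: mod_mult_eq)
  finally show ?case using ne(3) \<open>m mod 24 \<in> {1, 5, 7, 11}\<close> by auto
qed

text \<open>The class 23 of \<open>24 * t - 1\<close> lies outside the subgroup, so some prime
  divisor does too. That prime cannot divide the neighbour \<open>24 * t\<close>, hence it is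
  neither 2 nor 3 and is coprime to \<open>t\<close>.\<close>

lemma exists_inert_prime:
  fixes t :: nat
  assumes "t > 0"
  obtains p :: nat where "prime p" "p > 3" "coprime p t" "p mod 24 \<notin> {1, 5, 7, 11}"
proof -
  obtain s where "t = Suc s" using assms by (cases t) auto
  then have "24 * t - 1 = 23 + 24 * s" by simp
  then have "(24 * t - 1) mod 24 = 23" by simp
  then have "(24 * t - 1) mod 24 \<notin> {1, 5, 7, 11}" by simp
  moreover have "24 * t - 1 > 0" using assms by simp
  ultimately obtain p where p: "prime p" "p dvd 24 * t - 1" "p mod 24 \<notin> {1, 5, 7, 11}"
    using mod_24_of_prime_divisors by blast
  have *: "\<not> p dvd 24 * t"
  proof
    assume "p dvd 24 * t"
    then have "p dvd 24 * t - (24 * t - 1)" using p(2) by (rule dvd_diff_nat)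
    then show False using assms p(1) by simp
  qed
  have "(2::nat) dvd 24 * t" "(3::nat) dvd 24 * t" by (intro dvd_mult2, simp)+
  then have "p \<noteq> 2" "p \<noteq> 3" using * by blast+
  then have "p > 3" using prime_ge_2_nat[OF p(1)] by linarith
  moreover have "coprime p t" using * p(1) by (meson dvd_mult prime_imp_coprime)
  ultimately show ?thesis using that p by blast
qed

text \<open>If \<open>p\<close> did not divide \<open>x\<close>, then dividing
  \<open>2 * (3 * x^2 + 8 * y^2) = 6 * x^2 + (4 * y)^2\<close> by \<open>x^2\<close> modulo
  \<open>p\<close> would make -6 a square, against \<open>prime_dvd_square_add_6\<close>.\<close>

lemma inert_prime_dvd_form:
  fixes p :: nat and x y :: int
  assumes p: "prime p" "p > 3" "p mod 24 \<notin> {1, 5, 7, 11}"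
    and dvd: "int p dvd 3 * x\<^sup>2 + 8 * y\<^sup>2"
  shows "int p dvd x" "int p dvd y"
proof -
  have prime: "prime (int p)" using p(1) by simp
  have small: "\<not> int p dvd 2" "\<not> int p dvd 3"
    using p(2) by (auto dest: zdvd_imp_le)
  show x: "int p dvd x"
  proof (rule ccontr)
    assume "\<not> int p dvd x"
    then have "coprime x (int p)" using prime by (metis coprime_commute prime_imp_coprime)
    then obtain z where z: "[x * z = 1] (mod int p)"
      using cong_solve_coprime_int by blast
    define w where "w = nat \<bar>4 * y * z\<bar>"
    have "[(x * z)\<^sup>2 = 1\<^sup>2] (mod int p)" using z by (rule cong_pow)
    then have "int p dvd (x * z)\<^sup>2 - 1" by (simp add: cong_iff_dvd_diff)
    moreover have "int (w\<^sup>2 + 6) = 2 * z\<^sup>2 * (3 * x\<^sup>2 + 8 * y\<^sup>2) - 6 * ((x * z)\<^sup>2 - 1)"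
    proof -
      have "int w ^ 2 = (4 * y * z)\<^sup>2" by (simp add: w_def)
      then show ?thesis by (simp add: power2_eq_square algebra_simps)
    qed
    ultimately have "int p dvd int (w\<^sup>2 + 6)"
      using dvd by (simp only:) (rule dvd_diff[OF dvd_mult dvd_mult])
    then have "p dvd w\<^sup>2 + 6" by (simp only: int_dvd_int_iff)
    then show False using prime_dvd_square_add_6 p by blast
  qed
  have "int p dvd 3 * x\<^sup>2" using x by (simp add: power2_eq_square)
  then have "int p dvd 8 * y\<^sup>2" using dvd dvd_add_right_iff by blast
  then have "int p dvd 2 ^ 3 * y\<^sup>2" by simp
  moreover have "\<not> int p dvd 2 ^ 3" using prime small(1) prime_dvd_power by blast
  ultimately have "int p dvd y\<^sup>2" using prime_dvd_multD[OF prime] by blast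
  then show "int p dvd y" using prime prime_dvd_power by blast
qed

lemma infinite_not_form:
  fixes r t :: int
  assumes "t \<ge> 1"
  shows "infinite {N :: nat. [int N = r] (mod t) \<and> (\<nexists>x y :: int. 12 * int N = 3 * x\<^sup>2 + 8 * y\<^sup>2 + 1)}"
    (is "infinite ?A")
proof -
  obtain p where p: "prime p" "p > 3" "coprime p (nat t)" "p mod 24 \<notin> {1, 5, 7, 11}"
    using exists_inert_prime[of "nat t"] assms by auto
  have "coprime (int p) t"
    using p(3) assms by (metis coprime_int_iff int_nat_eq zero_le_one order_trans)
  then have "coprime t ((int p)\<^sup>2)" by (simp add: coprime_commute)
  have "coprime 12 ((int p)\<^sup>2)"
  proof -
    have "\<not> p dvd 12"
    proof
      assume "p dvd 12"
      then have "p dvd 2 ^ 2 * 3" by simp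
      then have "p dvd 2 \<or> p dvd 3" using p(1) by (metis prime_dvd_mult_iff prime_dvd_power)
      then show False using p(2) by (auto dest: dvd_imp_le)
    qed
    then have "coprime p 12" using p(1) by (simp add: prime_imp_coprime)
    then have "coprime (int p) (int 12)" by (subst coprime_int_iff)
    then show ?thesis by (simp add: coprime_commute)
  qed
  \<comment> \<open>With \<open>c\<close> inverse to 12, the residue \<open>c * (1 + p)\<close> for
    \<open>N\<close> makes \<open>12 * N - 1\<close> congruent to \<open>p\<close> modulo
    \<open>p^2\<close>, so \<open>p\<close> divides it exactly once.\<close>
  then obtain c where c: "[12 * c = 1] (mod (int p)\<^sup>2)"
    using cong_solve_coprime_int by blast
  obtain n where n: "[n = r] (mod t)" "[n = c * (1 + int p)] (mod (int p)\<^sup>2)"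
    using binary_chinese_remainder_int[OF \<open>coprime t ((int p)\<^sup>2)\<close>] by blast
  define L where "L = t * (int p)\<^sup>2"
  have "L \<ge> 1" using assms p(2) unfolding L_def by (simp add: int_one_le_iff_zero_less)
  \<comment> \<open>As \<open>n mod L\<close> is nonnegative, \<open>nat\<close> loses
    nothing.\<close>
  define N where "N k = nat (n mod L + int k * L)" for k :: nat
  have N: "int (N k) = n mod L + int k * L" for k
    using \<open>L \<ge> 1\<close> unfolding N_def by simp
  have "inj N"
  proof (rule injI)
    fix j k assume "N j = N k"
    then have "int j * L = int k * L" using N[of j] N[of k] by linarith
    then show "j = k" using \<open>L \<ge> 1\<close> by auto
  qed
  then have "infinite (range N)" by (rule range_inj_infinite)
  moreover have "N k \<in> ?A" for k
  proof -
    have L: "[int (N k) = n] (mod L)" unfolding N by (simp add: cong_def)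
    have "[int (N k) = n] (mod t)" "[int (N k) = n] (mod (int p)\<^sup>2)"
      using L unfolding L_def by (auto intro: cong_dvd_modulus)
    then have 1: "[int (N k) = r] (mod t)" and 2: "[int (N k) = c * (1 + int p)] (mod (int p)\<^sup>2)"
      using n cong_trans by blast+
    have "[12 * int (N k) = 12 * c * (1 + int p)] (mod (int p)\<^sup>2)"
      using cong_scalar_left[OF 2, of 12] by (simp add: mult.assoc)
    also have "[12 * c * (1 + int p) = 1 * (1 + int p)] (mod (int p)\<^sup>2)"
      using c by (rule cong_scalar_right)
    finally have 3: "(int p)\<^sup>2 dvd 12 * int (N k) - (1 + int p)"
      by (simp add: cong_iff_dvd_diff)
    have "12 * int (N k) \<noteq> 3 * x\<^sup>2 + 8 * y\<^sup>2 + 1" for x y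
    proof
      assume eq: "12 * int (N k) = 3 * x\<^sup>2 + 8 * y\<^sup>2 + 1"
      have 4: "(int p)\<^sup>2 dvd (3 * x\<^sup>2 + 8 * y\<^sup>2) - int p" using 3 eq by (simp add: algebra_simps)
      then have "int p dvd (3 * x\<^sup>2 + 8 * y\<^sup>2) - int p"
        by (rule dvd_trans[rotated]) simp
      then have "int p dvd (3 * x\<^sup>2 + 8 * y\<^sup>2 - int p) + int p" by (intro dvd_add) auto
      then have "int p dvd 3 * x\<^sup>2 + 8 * y\<^sup>2" by simp
      then have "int p dvd x" "int p dvd y" using inert_prime_dvd_form p by blast+
      then have "(int p)\<^sup>2 dvd 3 * x\<^sup>2 + 8 * y\<^sup>2" by (intro dvd_add dvd_mult dvd_power_same)
      then have "(int p)\<^sup>2 dvd (3 * x\<^sup>2 + 8 * y\<^sup>2) - ((3 * x\<^sup>2 + 8 * y\<^sup>2) - int p)"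
        using 4 by (rule dvd_diff)
      then have "(int p)\<^sup>2 dvd int p" by simp
      then have "(int p)\<^sup>2 \<le> int p" using p(2) by (intro zdvd_imp_le) auto
      then show False using p(2) by (simp add: power2_eq_square)
    qed
    with 1 show ?thesis by blast
  qed
  then have "range N \<subseteq> ?A" by (rule image_subsetI)
  ultimately show ?thesis using finite_subset by blast
qed

section \<open>Infinite products of formal power series\<close>

text \<open>Divisibility of a difference by \<open>fps_X ^ N\<close> serves as congruence to order
  \<open>N\<close>. Most limit arguments below are such congruences, which make sense over any
  commutative ring.\<close>

lemma fps_X_power_dvd_iff:
  "fps_X ^ N dvd (f :: 'a :: comm_ring_1 fps) \<longleftrightarrow> (\<forall>i<N. fps_nth f i = 0)"
proof
  assume "\<forall>i<N. fps_nth f i = 0"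
  then have "f = fps_X ^ N * fps_shift N f"
    by (auto simp: fps_eq_iff fps_X_power_mult_nth)
  then show "fps_X ^ N dvd f" by (metis dvd_triv_left)
qed (auto elim!: dvdE simp: fps_X_power_mult_nth)

lemma fps_eq_if_cong_fps_X_powers:
  fixes f g :: "'a :: comm_ring_1 fps"
  assumes "\<And>N. fps_X ^ N dvd f - g"
  shows "f = g"
  using assms unfolding fps_X_power_dvd_iff by (auto simp: fps_eq_iff)

lemma dvd_mult_diff_mult:
  fixes d :: "'a :: comm_ring_1"
  assumes "d dvd a - b" "d dvd a' - b'"
  shows "d dvd a * a' - b * b'"
proof -
  have "a * a' - b * b' = a * (a' - b') + b' * (a - b)" by (simp add: algebra_simps)
  then show ?thesis using assms by simp
qed

lemma dvd_diff_trans: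
  fixes d :: "'a :: comm_ring_1"
  assumes "d dvd a - b" "d dvd b - c"
  shows "d dvd a - c"
  using dvd_add[OF assms] by simp

lemma dvd_diff_sym:
  fixes d :: "'a :: comm_ring_1"
  assumes "d dvd a - b"
  shows "d dvd b - a"
  using assms by (metis dvd_minus_iff minus_diff_eq)

lemma dvd_prod_minus_1:
  fixes d :: "'a :: comm_ring_1" and k :: nat
  assumes "\<And>r. r < k \<Longrightarrow> d dvd g r - 1"
  shows "d dvd (\<Prod>r<k. g r) - 1"
  using assms
proof (induction k)
  case (Suc k)
  have "d dvd (\<Prod>r<k. g r) * g k - 1 * 1"
    by (intro dvd_mult_diff_mult Suc) (auto intro: Suc.prems)
  then show ?case by simp
qed simp

text \<open>An explicit rate at which the factors approach 1 replaces convergence in a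
  topology.\<close>

definition near_one :: "(nat \<Rightarrow> 'a :: comm_ring_1 fps) \<Rightarrow> bool" where
  "near_one f \<longleftrightarrow> (\<forall>i. fps_X ^ Suc i dvd f i - 1)"

text \<open>
  The product of all \<open>f i\<close> if \<^term>\<open>near_one f\<close>: the factors with \<open>i \<ge> n\<close> do not affect the
  coefficients up to degree \<open>n\<close>.
\<close>

definition fps_prodinf :: "(nat \<Rightarrow> 'a :: comm_ring_1 fps) \<Rightarrow> 'a fps" where
  "fps_prodinf f = Abs_fps (\<lambda>n. fps_nth (\<Prod>i<n. f i) n)"

lemma near_one_prod_diff:
  assumes "near_one f" "n \<le> m"
  shows "fps_X ^ Suc n dvd (\<Prod>i<m. f i) - (\<Prod>i<n. f i)"
  using assms(2)
proof (induction m rule: dec_induct)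
  case (step m)
  have "fps_X ^ Suc n dvd (fps_X ^ Suc m :: 'a fps)"
    using step.hyps by (intro le_imp_power_dvd) simp
  then have "fps_X ^ Suc n dvd f m - 1"
    using assms(1) dvd_trans unfolding near_one_def by blast
  moreover have "(\<Prod>i<Suc m. f i) - (\<Prod>i<n. f i) =
      (\<Prod>i<m. f i) * (f m - 1) + ((\<Prod>i<m. f i) - (\<Prod>i<n. f i))"
    by (simp add: algebra_simps)
  ultimately show ?case using step.IH by (metis dvd_add dvd_mult)
qed simp

lemma fps_prodinf_diff:
  assumes "near_one f" "N \<le> Suc n"
  shows "fps_X ^ N dvd fps_prodinf f - (\<Prod>i<n. f i)"
  unfolding fps_X_power_dvd_iff
proof (intro allI impI)
  fix i assume "i < N"
  then have "i \<le> n" using assms(2) by simp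
  then show "fps_nth (fps_prodinf f - (\<Prod>i<n. f i)) i = 0"
    using near_one_prod_diff[OF assms(1) \<open>i \<le> n\<close>]
    unfolding fps_X_power_dvd_iff by (simp add: fps_prodinf_def)
qed

text \<open>One long enough partial product for each order suffices, which suits both regrouped
  products and topological limits.\<close>

lemma fps_prodinf_eqI:
  assumes "near_one f" "\<And>N. \<exists>n\<ge>N. fps_X ^ N dvd P - (\<Prod>i<n. f i)"
  shows "P = fps_prodinf f"
proof (rule fps_eq_if_cong_fps_X_powers)
  fix N
  obtain n where n: "n \<ge> N" "fps_X ^ N dvd P - (\<Prod>i<n. f i)" using assms(2) by blast
  have "fps_X ^ N dvd fps_prodinf f - (\<Prod>i<n. f i)"
    using fps_prodinf_diff[OF assms(1)] n(1) by simp
  with n(2) show "fps_X ^ N dvd P - fps_prodinf f"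
    by (metis dvd_diff_trans dvd_minus_iff minus_diff_eq)
qed

lemma near_one_mult:
  assumes "near_one f" "near_one g"
  shows "near_one (\<lambda>i. f i * g i)"
  using assms dvd_mult_diff_mult[of _ _ 1 _ 1] unfolding near_one_def by fastforce

lemma fps_prodinf_mult:
  assumes "near_one f" "near_one g"
  shows "fps_prodinf (\<lambda>i. f i * g i) = fps_prodinf f * fps_prodinf g"
proof (rule sym, rule fps_prodinf_eqI[OF near_one_mult[OF assms]])
  fix N
  have "fps_X ^ N dvd fps_prodinf f * fps_prodinf g - (\<Prod>i<N. f i) * (\<Prod>i<N. g i)"
    by (intro dvd_mult_diff_mult fps_prodinf_diff assms) auto
  then show "\<exists>n\<ge>N. fps_X ^ N dvd fps_prodinf f * fps_prodinf g - (\<Prod>i<n. f i * g i)"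
    by (auto simp: prod.distrib)
qed

lemma near_one_blocks:
  assumes "near_one f" "m > 0"
  shows "near_one (\<lambda>i. \<Prod>r<m. f (i * m + r))"
  unfolding near_one_def
proof (intro allI dvd_prod_minus_1)
  fix i r
  have "i * 1 \<le> i * m" using assms(2) by (intro mult_le_mono2) simp
  then have "Suc i \<le> Suc (i * m + r)" by linarith
  then have "fps_X ^ Suc i dvd (fps_X ^ Suc (i * m + r) :: 'a fps)"
    by (rule le_imp_power_dvd)
  then show "fps_X ^ Suc i dvd f (i * m + r) - 1"
    using assms(1) dvd_trans unfolding near_one_def by blast
qed

text \<open>The first \<open>N\<close> blocks contain exactly the first \<open>N * m\<close>
  factors. The cases \<open>m = 2\<close> and \<open>m = 3\<close> serve to sort exponents by
  residue class.\<close>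

lemma fps_prodinf_blocks:
  assumes "near_one f" "m > 0"
  shows "fps_prodinf f = fps_prodinf (\<lambda>i. \<Prod>r<m. f (i * m + r))"
proof (rule fps_prodinf_eqI[OF near_one_blocks[OF assms]])
  fix N
  have "(\<Prod>r<m. f (i * m + r)) = (\<Prod>r\<in>{i * m..<i * m + m}. f r)" for i
    using prod.shift_bounds_nat_ivl[of f 0 "i * m" m] by (simp add: atLeast0LessThan add.commute)
  then have "(\<Prod>i<N. \<Prod>r<m. f (i * m + r)) = (\<Prod>i<N * m. f i)"
    using prod.nat_group[of f m N] by simp
  moreover have "N * 1 \<le> N * m" using assms(2) by (intro mult_le_mono2) simp
  then have "N \<le> Suc (N * m)" by linarith
  ultimately have "fps_X ^ N dvd fps_prodinf f - (\<Prod>i<N. \<Prod>r<m. f (i * m + r))"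
    using fps_prodinf_diff[OF assms(1)] by metis
  then show "\<exists>n\<ge>N. fps_X ^ N dvd fps_prodinf f - (\<Prod>i<n. \<Prod>r<m. f (i * m + r))" by blast
qed

lemma near_one_fps_X_power:
  assumes "\<And>i. i < g i"
  shows "near_one (\<lambda>i. 1 - fps_X ^ g i)" "near_one (\<lambda>i. 1 + c * fps_X ^ g i)"
  using assms unfolding near_one_def
  by (auto intro!: dvd_mult le_imp_power_dvd Suc_leI simp del: power_Suc)

lemma fps_prodinf_nth_0: "fps_nth (fps_prodinf f) 0 = 1"
  by (simp add: fps_prodinf_def)

lemma fps_unit_if_nth_0:
  fixes f :: "'a :: comm_ring_1 fps"
  assumes "fps_nth f 0 = 1"
  obtains g where "f * g = 1"
  using fps_right_inverse[of f 1] assms by auto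

section \<open>Euler products and their odd parts\<close>

definition euler_fps :: "nat \<Rightarrow> 'a :: comm_ring_1 fps" where
  "euler_fps k = fps_prodinf (\<lambda>i. 1 - fps_X ^ (k * Suc i))"

text \<open>For \<open>k > 0\<close> this is the q-Pochhammer product
  \<open>(q^k; q^(2k))_inf\<close>, the quotient of the Euler products of index \<open>k\<close> and
  \<open>2 * k\<close>.\<close>

definition odd_fps :: "nat \<Rightarrow> 'a :: comm_ring_1 fps" where
  "odd_fps k = fps_prodinf (\<lambda>i. 1 - fps_X ^ (k * (2 * i + 1)))"

lemma near_one_euler: "k > 0 \<Longrightarrow> near_one (\<lambda>i. 1 - fps_X ^ (k * Suc i))"
  by (rule near_one_fps_X_power) (metis One_nat_def Suc_leI lessI less_le_trans mult_le_mono1 nat_mult_1)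

lemma near_one_odd: "k > 0 \<Longrightarrow> near_one (\<lambda>i. 1 - fps_X ^ (k * (2 * i + 1)))"
proof (rule near_one_fps_X_power)
  fix i assume "k > 0"
  then have "1 * (2 * i + 1) \<le> k * (2 * i + 1)" by (intro mult_le_mono1) simp
  moreover have "i < 1 * (2 * i + 1)" by simp
  ultimately show "i < k * (2 * i + 1)" by (rule less_le_trans[rotated])
qed

lemma euler_fps_split:
  assumes "k > 0"
  shows "euler_fps k = (odd_fps k * euler_fps (2 * k) :: 'a :: comm_ring_1 fps)"
proof -
  have *: "k * Suc (i * 2 + 0) = k * (2 * i + 1)" "k * Suc (i * 2 + 1) = 2 * k * Suc i" for i
    by (simp_all add: algebra_simps)
  have "(\<Prod>r<2. g r) = g 0 * g 1" for g :: "nat \<Rightarrow> 'a fps" by (simp add: numeral_2_eq_2)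
  then have blocks: "(\<Prod>r<2. 1 - fps_X ^ (k * Suc (i * 2 + r))) =
      (1 - fps_X ^ (k * (2 * i + 1))) * (1 - fps_X ^ (2 * k * Suc i) :: 'a fps)" for i
    by (simp only: *)
  have "0 < (2 :: nat)" by simp
  note fps_prodinf_blocks[OF near_one_euler[OF assms, where 'a = 'a] this]
  then have "euler_fps k = fps_prodinf (\<lambda>i. (1 - fps_X ^ (k * (2 * i + 1))) * (1 - fps_X ^ (2 * k * Suc i)) :: 'a fps)"
    unfolding euler_fps_def by (simp only: blocks)
  also have "\<dots> = odd_fps k * euler_fps (2 * k)"
    unfolding euler_fps_def odd_fps_def
    using assms by (intro fps_prodinf_mult near_one_odd near_one_euler) simp_all
  finally show ?thesis .
qed

lemma euler_fps_nonzero: "euler_fps k \<noteq> (0 :: 'a :: comm_ring_1 fps)"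
  using fps_prodinf_nth_0 unfolding euler_fps_def by (metis fps_zero_nth zero_neq_one)

lemma odd_fps_nonzero: "odd_fps k \<noteq> (0 :: 'a :: comm_ring_1 fps)"
  using fps_prodinf_nth_0 unfolding odd_fps_def by (metis fps_zero_nth zero_neq_one)

text \<open>Identities over the integers are carried to \<open>real\<close>, where
  \<open>cphi2_gf\<close> lives, and to \<open>bit\<close> for reduction modulo 2.\<close>

definition fps_of_int :: "int fps \<Rightarrow> 'a :: comm_ring_1 fps" where
  "fps_of_int f = Abs_fps (\<lambda>n. of_int (fps_nth f n))"

lemma fps_of_int_nth [simp]: "fps_nth (fps_of_int f) n = of_int (fps_nth f n)"
  by (simp add: fps_of_int_def)

lemma fps_of_int_simps [simp]:
  "fps_of_int 1 = 1" "fps_of_int fps_X = fps_X"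
  "fps_of_int (f + g) = fps_of_int f + fps_of_int g"
  "fps_of_int (f - g) = fps_of_int f - fps_of_int g"
  "fps_of_int (f * g) = fps_of_int f * fps_of_int g"
  by (auto simp: fps_eq_iff fps_X_nth fps_mult_nth)

lemma fps_of_int_power [simp]: "fps_of_int (f ^ n) = fps_of_int f ^ n"
  by (induction n) simp_all

lemma fps_of_int_prod: "fps_of_int (prod f A) = (\<Prod>x\<in>A. fps_of_int (f x))"
  by (induction A rule: infinite_finite_induct) simp_all

lemma fps_of_int_prodinf:
  "fps_of_int (fps_prodinf f) = fps_prodinf (\<lambda>i. fps_of_int (f i))"
  by (simp add: fps_eq_iff fps_prodinf_def flip: fps_of_int_prod)

lemma fps_of_int_euler [simp]: "fps_of_int (euler_fps k) = euler_fps k"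
  by (simp add: euler_fps_def fps_of_int_prodinf)

lemma fps_of_int_odd [simp]: "fps_of_int (odd_fps k) = odd_fps k"
  by (simp add: odd_fps_def fps_of_int_prodinf)

section \<open>The Jacobi triple product\<close>

fun qbinom :: "'a :: comm_ring_1 \<Rightarrow> nat \<Rightarrow> nat \<Rightarrow> 'a" where
  "qbinom q n 0 = 1"
| "qbinom q 0 (Suc k) = 0"
| "qbinom q (Suc n) (Suc k) = qbinom q n k + q ^ Suc k * qbinom q n (Suc k)"

lemma qbinom_eq_0: "n < k \<Longrightarrow> qbinom q n k = 0"
  by (induction q n k rule: qbinom.induct) auto

text \<open>The two terms of the q-Pascal rule contribute the factors \<open>1 - q ^ Suc k\<close>
  and \<open>q ^ Suc k - q ^ Suc n\<close>, whose sum is \<open>1 - q ^ Suc n\<close>.\<close>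

lemma qbinom_mult_prods:
  "k \<le> n \<Longrightarrow> qbinom q n k * (\<Prod>i<k. 1 - q ^ Suc i) * (\<Prod>i<n - k. 1 - q ^ Suc i) = (\<Prod>i<n. 1 - q ^ Suc i)"
proof (induction q n k rule: qbinom.induct)
  case (3 q n k)
  define P where "P m = (\<Prod>i<m. 1 - q ^ Suc i)" for m
  have P: "P (Suc m) = P m * (1 - q ^ Suc m)" for m by (simp add: P_def)
  have IH1: "qbinom q n k * P k * P (n - k) = P n" using 3 by (simp add: P_def)
  have "q ^ Suc k * qbinom q n (Suc k) * P (Suc k) * P (n - k) = P n * (q ^ Suc k - q ^ Suc n)"
  proof (cases "k = n")
    case True
    then show ?thesis by (simp add: qbinom_eq_0)
  next
    case False
    then have "Suc k \<le> n" using 3 by simp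
    then have IH2: "qbinom q n (Suc k) * P (Suc k) * P (n - Suc k) = P n" using 3 by (simp add: P_def)
    have "P (n - k) = P (n - Suc k) * (1 - q ^ (n - k))"
      using P[of "n - Suc k"] \<open>Suc k \<le> n\<close> by (metis Suc_diff_Suc Suc_le_lessD)
    moreover have "q ^ Suc k * q ^ (n - k) = q ^ Suc n"
      unfolding power_add[symmetric] using \<open>Suc k \<le> n\<close> by simp
    moreover have "q ^ Suc k * qbinom q n (Suc k) * P (Suc k) * (P (n - Suc k) * (1 - q ^ (n - k))) =
        (qbinom q n (Suc k) * P (Suc k) * P (n - Suc k)) * (q ^ Suc k - q ^ Suc k * q ^ (n - k))"
      by (simp only: mult_ac right_diff_distrib mult_1_left mult_1_right)
    ultimately show ?thesis using IH2 by metis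
  qed
  moreover have "qbinom q n k * P (Suc k) * P (n - k) = P n * (1 - q ^ Suc k)"
  proof -
    have "qbinom q n k * P (Suc k) * P (n - k) = (qbinom q n k * P k * P (n - k)) * (1 - q ^ Suc k)"
      unfolding P by (simp only: mult_ac)
    then show ?thesis using IH1 by metis
  qed
  ultimately have "(qbinom q n k + q ^ Suc k * qbinom q n (Suc k)) * P (Suc k) * P (n - k) = P (Suc n)"
    unfolding P[of n] by (simp only: distrib_right) (simp only: right_diff_distrib, simp)
  then show ?case by (simp add: P_def)
qed auto

text \<open>The homogeneous form lets \<open>y\<close> be a power of \<open>fps_X\<close> later,
  where a negative power would otherwise occur. Splitting off the factor \<open>i = 0\<close>
  replaces \<open>z\<close> by \<open>z * q\<close>, so the induction needs arbitrary
  \<open>z\<close>.\<close>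

lemma qbinomial_theorem:
  fixes y z q :: "'a :: comm_ring_1"
  shows "(\<Prod>i<m. y + z * q ^ i) = (\<Sum>k\<le>m. q ^ (k choose 2) * qbinom q m k * z ^ k * y ^ (m - k))"
proof (induction m arbitrary: z)
  case (Suc m)
  define c where "c k = q ^ (k choose 2) * q ^ k * qbinom q m k" for k
  have "(\<Prod>i<Suc m. y + z * q ^ i) = (y + z) * (\<Prod>i<m. y + (z * q) * q ^ i)"
    by (subst prod.lessThan_Suc_shift) (simp add: mult.assoc)
  also have "\<dots> = (y + z) * (\<Sum>k\<le>m. c k * z ^ k * y ^ (m - k))"
    unfolding Suc.IH by (simp add: c_def power_mult_distrib mult_ac)
  also have "\<dots> = (\<Sum>k\<le>m. c k * z ^ k * y ^ (Suc m - k)) + (\<Sum>k\<le>m. c k * z ^ Suc k * y ^ (m - k))"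
    by (simp add: distrib_left distrib_right sum_distrib_left mult_ac Suc_diff_le sum.distrib)
  also have "(\<Sum>k\<le>m. c k * z ^ k * y ^ (Suc m - k)) = (\<Sum>k\<le>Suc m. c k * z ^ k * y ^ (Suc m - k))"
    by (simp add: c_def qbinom_eq_0)
  also have "\<dots> = y ^ Suc m + (\<Sum>k\<le>m. c (Suc k) * z ^ Suc k * y ^ (m - k))"
    by (subst sum.atMost_Suc_shift) (simp add: c_def numeral_2_eq_2)
  also have "\<dots> + (\<Sum>k\<le>m. c k * z ^ Suc k * y ^ (m - k)) =
      y ^ Suc m + (\<Sum>k\<le>m. (c (Suc k) + c k) * z ^ Suc k * y ^ (m - k))"
    by (simp add: distrib_right sum.distrib)
  also have "\<dots> = y ^ Suc m + (\<Sum>k\<le>m. (q ^ (Suc k choose 2) * qbinom q (Suc m) (Suc k)) * z ^ Suc k * y ^ (m - k))"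
    by (simp add: c_def numeral_2_eq_2 power_add algebra_simps)
  also have "\<dots> = (\<Sum>k\<le>Suc m. q ^ (k choose 2) * qbinom q (Suc m) k * z ^ k * y ^ (Suc m - k))"
    by (subst sum.atMost_Suc_shift) (simp add: binomial_eq_0)
  finally show ?case .
qed (simp add: binomial_eq_0)

text \<open>When \<open>l\<close> and \<open>m - l\<close> are both large, all three products in
  \<open>qbinom_mult_prods\<close> are close to the Euler product, and one copy of it
  cancels.\<close>

lemma qbinom_limit:
  assumes "k > 0" "N \<le> l" "l + N \<le> m"
  shows "fps_X ^ N dvd qbinom (fps_X ^ k :: 'a :: comm_ring_1 fps) m l * euler_fps k - 1"
proof -
  define Q :: "'a fps" where "Q = qbinom (fps_X ^ k) m l"
  define P :: "nat \<Rightarrow> 'a fps" where "P i = (\<Prod>x<i. 1 - (fps_X ^ k) ^ Suc x)" for i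
  have P: "fps_X ^ N dvd euler_fps k - P i" if "N \<le> i" for i
    unfolding P_def euler_fps_def power_mult[symmetric]
    using that by (intro fps_prodinf_diff near_one_euler assms) simp
  have "Q * P l * P (m - l) = P m"
    unfolding Q_def P_def using assms by (intro qbinom_mult_prods) simp
  moreover have "fps_X ^ N dvd Q * euler_fps k * euler_fps k - Q * P l * P (m - l)"
    using assms by (intro dvd_mult_diff_mult P) simp_all
  moreover have "fps_X ^ N dvd P m - euler_fps k"
    using assms by (intro dvd_diff_sym[OF P]) simp
  ultimately have *: "fps_X ^ N dvd Q * euler_fps k * euler_fps k - euler_fps k"
    using dvd_diff_trans by metis
  obtain J where J: "euler_fps k * J = (1 :: 'a fps)"
    using fps_unit_if_nth_0[of "euler_fps k"] fps_prodinf_nth_0 unfolding euler_fps_def by metis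
  have "(Q * euler_fps k * euler_fps k - euler_fps k) * J = Q * euler_fps k * (euler_fps k * J) - euler_fps k * J"
    by (simp only: left_diff_distrib mult.assoc)
  also have "\<dots> = Q * euler_fps k - 1" unfolding J by simp
  finally show ?thesis using * unfolding Q_def by (metis dvd_mult2)
qed

definition theta_exp :: "nat \<Rightarrow> nat \<Rightarrow> int \<Rightarrow> nat" where
  "theta_exp a b j = nat (int a * (j * (j + 1) div 2) + int b * (j * (j - 1) div 2))"

text \<open>For \<open>s = 1\<close> or \<open>s = -1\<close> and positive \<open>a\<close>,
  \<open>b\<close> this is Ramanujan's general theta function at \<open>s q^a\<close> and
  \<open>s q^b\<close>. The sign there is \<open>s^(j^2)\<close>, which depends only on the parity
  of \<open>j\<close>.\<close>

definition theta_fps :: "int \<Rightarrow> nat \<Rightarrow> nat \<Rightarrow> int fps" where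
  "theta_fps s a b = Abs_fps (\<lambda>n. \<Sum>j | theta_exp a b j = n. s ^ nat \<bar>j\<bar>)"

lemma mult_consecutive_nonneg: "0 \<le> j * (j + 1)" "0 \<le> j * (j - 1)" for j :: int
proof -
  have "j \<le> -1 \<or> 0 \<le> j" "j \<le> 0 \<or> 1 \<le> j" by linarith+
  then show "0 \<le> j * (j + 1)" "0 \<le> j * (j - 1)" by (auto simp: zero_le_mult_iff)
qed

lemma int_theta_exp:
  "2 * int (theta_exp a b j) = int a * (j * (j + 1)) + int b * (j * (j - 1))"
proof -
  define u v where "u = j * (j + 1) div 2" and "v = j * (j - 1) div 2"
  have u: "j * (j + 1) = 2 * u" and v: "j * (j - 1) = 2 * v" unfolding u_def v_def by simp_all
  have "u \<ge> 0" "v \<ge> 0" using u v mult_consecutive_nonneg[of j] by simp_all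
  then have "int (theta_exp a b j) = int a * u + int b * v"
    unfolding theta_exp_def u_def[symmetric] v_def[symmetric] by simp
  then show ?thesis unfolding u v by (simp add: algebra_simps)
qed

text \<open>Lowering \<open>a\<close> and \<open>b\<close> to 1 leaves the exponent
  \<open>j^2\<close>. Hence only finitely many \<open>j\<close> contribute to each coefficient of
  the theta series.\<close>

lemma abs_le_theta_exp:
  assumes "a > 0" "b > 0"
  shows "\<bar>j\<bar> \<le> int (theta_exp a b j)"
proof -
  have "1 * (j * (j + 1)) + 1 * (j * (j - 1)) \<le> 2 * int (theta_exp a b j)"
    unfolding int_theta_exp using assms by (intro add_mono mult_right_mono mult_consecutive_nonneg) simp_all
  then have "j * j \<le> int (theta_exp a b j)" by (simp add: algebra_simps)
  moreover have "\<bar>j\<bar> * 1 \<le> \<bar>j\<bar> * \<bar>j\<bar>"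
  proof (cases "j = 0")
    case False
    then have "1 \<le> \<bar>j\<bar>" by linarith
    then show ?thesis by (rule mult_left_mono) simp
  qed simp
  ultimately show ?thesis by (simp add: abs_mult_self_eq)
qed

text \<open>This is the q-binomial theorem with \<open>2 * n\<close> factors, base
  \<open>q = fps_X ^ (a + b)\<close>, \<open>y = q ^ n\<close> and \<open>z = s * fps_X ^ a\<close>.
  Taking \<open>z * q ^ i\<close> out of the first \<open>n\<close> factors and \<open>y\<close> out
  of the others yields the two families on the left.\<close>

lemma finite_jacobi_triple_product:
  fixes s :: int and n :: nat
  assumes s: "s * s = 1" and ab: "a > 0" "b > 0"
  shows "(\<Prod>i<n. (1 + fps_const s * fps_X ^ ((a + b) * i + a)) * (1 + fps_const s * fps_X ^ ((a + b) * i + b))) =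
    (\<Sum>j\<in>{-int n..int n}. fps_const (s ^ nat \<bar>j\<bar>) * fps_X ^ theta_exp a b j *
      qbinom (fps_X ^ (a + b)) (2 * n) (nat (int n + j)))"
    (is "?F = ?R")
proof -
  define k where "k = a + b"
  define c :: "int fps" where "c = fps_const s"
  define x :: "int fps" where "x = fps_X"
  \<comment> \<open>\<open>K\<close> is the total power of \<open>fps_X\<close> taken out of the
    \<open>2 * n\<close> factors.\<close>
  define K where "K = a * n + k * (n choose 2) + k * n * n"
  have cc: "c * c = 1" using s by (simp add: c_def)
  have "c ^ n * x ^ K * ?F = (\<Prod>i<2 * n. (x ^ k) ^ n + c * x ^ a * (x ^ k) ^ i)"
  proof -
    have 1: "(x ^ k) ^ n + c * x ^ a * (x ^ k) ^ i = c * x ^ a * (x ^ k) ^ i * (1 + c * x ^ (k * (n - Suc i) + b))"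
      if "i < n" for i
    proof -
      have "n = i + Suc (n - Suc i)" using that by simp
      then obtain d where d: "n = i + Suc d" and "n - Suc i = d" by simp
      have "x ^ a * (x ^ k) ^ i * x ^ (k * d + b) = (x ^ k) ^ n"
        unfolding d power_mult[symmetric] power_add[symmetric] k_def by (simp add: algebra_simps)
      then have "c * x ^ a * (x ^ k) ^ i * (c * x ^ (k * d + b)) = c * c * (x ^ k) ^ n"
        by (simp only: mult_ac)
      then show ?thesis unfolding \<open>n - Suc i = d\<close> cc by (simp add: distrib_left)
    qed
    have 2: "(x ^ k) ^ n + c * x ^ a * (x ^ k) ^ (n + i) = (x ^ k) ^ n * (1 + c * x ^ (k * i + a))" for i
    proof -
      have "c * x ^ a * (x ^ k) ^ (n + i) = (x ^ k) ^ n * (c * x ^ (k * i + a))"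
        by (simp only: power_mult[symmetric] power_add mult_ac)
      then show ?thesis by (simp add: distrib_left)
    qed
    have "(\<Prod>i<2 * n. (x ^ k) ^ n + c * x ^ a * (x ^ k) ^ i) =
        (\<Prod>i<n. (x ^ k) ^ n + c * x ^ a * (x ^ k) ^ i) * (\<Prod>i<n. (x ^ k) ^ n + c * x ^ a * (x ^ k) ^ (n + i))"
      using prod.nat_group[of "\<lambda>i. (x ^ k) ^ n + c * x ^ a * (x ^ k) ^ i" n 2]
        prod.shift_bounds_nat_ivl[of "\<lambda>i. (x ^ k) ^ n + c * x ^ a * (x ^ k) ^ i" 0 n n]
      by (simp add: numeral_2_eq_2 atLeast0LessThan add.commute)
    also have "(\<Prod>i<n. (x ^ k) ^ n + c * x ^ a * (x ^ k) ^ i) =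
        (\<Prod>i<n. c * x ^ a * (x ^ k) ^ i) * (\<Prod>i<n. 1 + c * x ^ (k * (n - Suc i) + b))"
      unfolding prod.distrib[symmetric] by (intro prod.cong refl 1) simp
    also have "(\<Prod>i<n. 1 + c * x ^ (k * (n - Suc i) + b)) = (\<Prod>i<n. 1 + c * x ^ (k * i + b))"
      by (rule prod.nat_diff_reindex)
    also have "(\<Prod>i<n. c * x ^ a * (x ^ k) ^ i) = c ^ n * x ^ (a * n + k * (n choose 2))"
    proof (induction n)
      case (Suc n)
      have "a * Suc n + k * (Suc n choose 2) = (a * n + k * (n choose 2)) + (a + k * n)"
        by (simp add: numeral_2_eq_2 algebra_simps)
      then show ?case using Suc by (simp add: power_add power_mult mult_ac)
    qed (simp add: binomial_eq_0)
    also have "(\<Prod>i<n. (x ^ k) ^ n + c * x ^ a * (x ^ k) ^ (n + i)) =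
        x ^ (k * n * n) * (\<Prod>i<n. 1 + c * x ^ (k * i + a))"
      unfolding 2 prod.distrib by (simp add: power_mult)
    finally show ?thesis
      unfolding K_def x_def c_def k_def by (simp add: prod.distrib power_add mult_ac)
  qed
  also have "\<dots> = (\<Sum>l\<le>2 * n. c ^ l * x ^ (K + theta_exp a b (int l - int n)) * qbinom (x ^ k) (2 * n) l)"
    unfolding qbinomial_theorem
  proof (rule sum.cong[OF refl])
    fix l assume "l \<in> {..2 * n}"
    \<comment> \<open>The exponents are compared over the integers after doubling, which makes
      binomial coefficients and triangular numbers polynomial.\<close>
    have ch: "2 * int (m choose 2) = int m * (int m - 1)" for m
    proof (induction m)
      case (Suc m)
      then show ?case by (simp add: numeral_2_eq_2 algebra_simps)
    qed (simp add: binomial_eq_0)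
    have "2 * int (k * (l choose 2) + a * l + k * n * (2 * n - l)) =
        int k * (2 * int (l choose 2)) + 2 * int a * int l + 2 * int k * int n * (2 * int n - int l)"
    proof -
      have "int (2 * n - l) = 2 * int n - int l" using \<open>l \<in> {..2 * n}\<close> by (simp add: of_nat_diff)
      then show ?thesis by (simp only: of_nat_add of_nat_mult) (simp add: algebra_simps)
    qed
    also have "\<dots> = 2 * int a * int n + int k * (2 * int (n choose 2)) + 2 * int k * int n * int n +
        2 * int (theta_exp a b (int l - int n))"
      unfolding ch int_theta_exp k_def by (simp add: algebra_simps)
    also have "\<dots> = 2 * int (K + theta_exp a b (int l - int n))"
      unfolding K_def by (simp add: algebra_simps)
    finally have *: "k * (l choose 2) + a * l + k * n * (2 * n - l) = K + theta_exp a b (int l - int n)"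
      by (metis mult_cancel_left of_nat_eq_iff zero_neq_numeral)
    show "(x ^ k) ^ (l choose 2) * qbinom (x ^ k) (2 * n) l * (c * x ^ a) ^ l * ((x ^ k) ^ n) ^ (2 * n - l) =
        c ^ l * x ^ (K + theta_exp a b (int l - int n)) * qbinom (x ^ k) (2 * n) l"
      unfolding *[symmetric] by (simp only: power_mult_distrib power_mult[symmetric] power_add mult_ac)
  qed
  also have "\<dots> = x ^ K * (\<Sum>l\<le>2 * n. c ^ l * x ^ theta_exp a b (int l - int n) * qbinom (x ^ k) (2 * n) l)"
    unfolding sum_distrib_left by (simp only: power_add mult_ac)
  finally have "x ^ K * (c ^ n * ?F) = x ^ K * (\<Sum>l\<le>2 * n. c ^ l * x ^ theta_exp a b (int l - int n) * qbinom (x ^ k) (2 * n) l)"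
    by (simp only: mult_ac)
  then have "c ^ n * ?F = (\<Sum>l\<le>2 * n. c ^ l * x ^ theta_exp a b (int l - int n) * qbinom (x ^ k) (2 * n) l)"
    by (simp add: x_def)
  \<comment> \<open>As \<open>c * c = 1\<close>, multiplying by \<open>c ^ n\<close> again frees
    \<open>?F\<close>, and the sign \<open>c ^ (n + l)\<close> depends only on the parity of
    \<open>l - n\<close>.\<close>
  then have "c ^ n * (c ^ n * ?F) = (\<Sum>l\<le>2 * n. c ^ (n + l) * x ^ theta_exp a b (int l - int n) * qbinom (x ^ k) (2 * n) l)"
    by (simp only: sum_distrib_left power_add mult_ac)
  moreover have "c ^ n * (c ^ n * ?F) = ?F"
  proof -
    have "c ^ n * (c ^ n * ?F) = (c * c) ^ n * ?F" by (simp only: power_mult_distrib mult.assoc)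
    then show ?thesis unfolding cc by simp
  qed
  moreover have "c ^ (n + l) = fps_const (s ^ nat \<bar>int l - int n\<bar>)" for l
  proof -
    have "s = 1 \<or> s = -1" using s by (simp add: zmult_eq_1_iff)
    moreover have "even (n + l) \<longleftrightarrow> even (nat \<bar>int l - int n\<bar>)"
      by (simp add: even_nat_iff) presburger
    ultimately have "s ^ (n + l) = s ^ nat \<bar>int l - int n\<bar>"
      by (auto simp: minus_one_power_iff)
    then show ?thesis by (simp add: c_def fps_const_power)
  qed
  ultimately have "?F = (\<Sum>l\<le>2 * n. fps_const (s ^ nat \<bar>int l - int n\<bar>) *
      x ^ theta_exp a b (int l - int n) * qbinom (x ^ k) (2 * n) l)" by simp
  also have "\<dots> = ?R"
    unfolding x_def k_def
    by (rule sum.reindex_bij_witness[of _ "\<lambda>j. nat (int n + j)" "\<lambda>l. int l - int n"]) auto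
  finally show ?thesis .
qed

text \<open>The finite version is multiplied by the Euler product and reduced modulo
  \<open>fps_X ^ N\<close>: for small \<open>j\<close> the q-binomial times the Euler product
  becomes 1, and for the other \<open>j\<close> the monomial itself vanishes.\<close>

lemma jacobi_triple_product:
  fixes s :: int
  assumes s: "s * s = 1" and ab: "a > 0" "b > 0"
  shows "theta_fps s a b =
    fps_prodinf (\<lambda>i. (1 + fps_const s * fps_X ^ ((a + b) * i + a)) * (1 + fps_const s * fps_X ^ ((a + b) * i + b)))
      * euler_fps (a + b)"
    (is "_ = fps_prodinf ?f * ?E")
proof (rule fps_eq_if_cong_fps_X_powers)
  fix N :: nat
  \<comment> \<open>For \<open>\<bar>j\<bar> < N\<close> both \<open>n + j\<close> and
    \<open>n - j\<close> are then at least \<open>N\<close>, as \<open>qbinom_limit\<close>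
    requires.\<close>
  define n where "n = 2 * N"
  define t where "t j = fps_const (s ^ nat \<bar>j\<bar>) * fps_X ^ theta_exp a b j" for j
  define q where "q j = qbinom (fps_X ^ (a + b) :: int fps) (2 * n) (nat (int n + j))" for j
  have "i < (a + b) * i + a" "i < (a + b) * i + b" for i
  proof -
    have "1 * i \<le> (a + b) * i" using ab by (intro mult_le_mono1) simp
    then show "i < (a + b) * i + a" "i < (a + b) * i + b" using ab by linarith+
  qed
  then have near: "near_one ?f" by (intro near_one_mult near_one_fps_X_power)
  have 1: "(\<Prod>i<n. ?f i) * ?E = (\<Sum>j\<in>{-int n..int n}. t j * (q j * ?E))"
    unfolding finite_jacobi_triple_product[OF assms] t_def q_def by (simp add: sum_distrib_right mult.assoc)
  have 2: "fps_X ^ N dvd (\<Sum>j\<in>{-int n..int n}. t j) - (\<Sum>j\<in>{-int n..int n}. t j * (q j * ?E))"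
    unfolding sum_subtractf[symmetric]
  proof (rule dvd_sum)
    fix j assume "j \<in> {-int n..int n}"
    show "fps_X ^ N dvd t j - t j * (q j * ?E)"
    proof (cases "N \<le> theta_exp a b j")
      case True
      then have "fps_X ^ N dvd t j" unfolding t_def by (intro dvd_mult le_imp_power_dvd)
      then show ?thesis by (intro dvd_diff dvd_mult2)
    next
      case False
      then have "\<bar>j\<bar> < int N" using abs_le_theta_exp[OF ab, of j] by linarith
      then have "fps_X ^ N dvd q j * ?E - 1"
        unfolding q_def using ab by (intro qbinom_limit) (auto simp: n_def)
      then have "fps_X ^ N dvd t j * (1 - q j * ?E)"
        by (intro dvd_mult) (rule dvd_diff_sym)
      then show ?thesis by (simp add: right_diff_distrib)
    qed
  qed
  have 3: "fps_X ^ N dvd theta_fps s a b - (\<Sum>j\<in>{-int n..int n}. t j)"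
    unfolding fps_X_power_dvd_iff
  proof (intro allI impI)
    fix i assume "i < N"
    have "{j. theta_exp a b j = i} = {j\<in>{-int n..int n}. theta_exp a b j = i}"
    proof -
      have "j \<in> {-int n..int n}" if "theta_exp a b j = i" for j
        using abs_le_theta_exp[OF ab, of j] \<open>i < N\<close> that unfolding n_def by auto
      then show ?thesis by blast
    qed
    then have "fps_nth (theta_fps s a b) i =
        (\<Sum>j\<in>{-int n..int n}. if theta_exp a b j = i then s ^ nat \<bar>j\<bar> else 0)"
      by (simp only: theta_fps_def fps_nth_Abs_fps sum.inter_filter finite_atLeastAtMost_int)
    also have "\<dots> = fps_nth (\<Sum>j\<in>{-int n..int n}. t j) i"
      unfolding t_def fps_sum_nth by (intro sum.cong) auto
    finally show "fps_nth (theta_fps s a b - (\<Sum>j\<in>{-int n..int n}. t j)) i = 0" by simp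
  qed
  have 4: "fps_X ^ N dvd (\<Prod>i<n. ?f i) * ?E - fps_prodinf ?f * ?E"
  proof -
    have "fps_X ^ N dvd fps_prodinf ?f - (\<Prod>i<n. ?f i)"
      by (rule fps_prodinf_diff[OF near]) (simp add: n_def)
    then have "fps_X ^ N dvd ((\<Prod>i<n. ?f i) - fps_prodinf ?f) * ?E"
      by (intro dvd_mult2) (rule dvd_diff_sym)
    then show ?thesis by (simp only: left_diff_distrib)
  qed
  show "fps_X ^ N dvd theta_fps s a b - fps_prodinf ?f * ?E"
    by (rule dvd_diff_trans[OF dvd_diff_trans[OF 3 2] 4[unfolded 1]])
qed

section \<open>Theta series\<close>

definition odd_plus_fps :: "'a :: comm_ring_1 fps" where
  "odd_plus_fps = fps_prodinf (\<lambda>i. 1 + fps_X ^ (2 * i + 1))"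

lemma odd_plus_fps_mult_odd_fps: "odd_plus_fps * odd_fps 1 = (odd_fps 2 :: 'a :: comm_ring_1 fps)"
proof -
  have "near_one (\<lambda>i. 1 + 1 * fps_X ^ (2 * i + 1) :: 'a fps)" by (rule near_one_fps_X_power) simp
  then have "odd_plus_fps * odd_fps 1 =
      fps_prodinf (\<lambda>i. (1 + fps_X ^ (2 * i + 1)) * (1 - fps_X ^ (1 * (2 * i + 1))) :: 'a fps)"
    unfolding odd_plus_fps_def odd_fps_def by (intro fps_prodinf_mult[symmetric] near_one_odd) simp_all
  also have "\<dots> = fps_prodinf (\<lambda>i. 1 - fps_X ^ (2 * (2 * i + 1)))"
  proof -
    have "(1 + fps_X ^ (2 * i + 1)) * (1 - fps_X ^ (1 * (2 * i + 1))) = (1 - fps_X ^ (2 * (2 * i + 1)) :: 'a fps)" for i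
    proof -
      have "fps_X ^ (2 * (2 * i + 1)) = fps_X ^ (2 * i + 1) * (fps_X ^ (2 * i + 1) :: 'a fps)"
        unfolding power_add[symmetric] by (rule arg_cong[where f = "power fps_X"]) simp
      moreover have "(1 + y) * (1 - y) = 1 - y * y" for y :: "'a fps" by (simp add: algebra_simps)
      ultimately show ?thesis by (simp only: mult_1_left)
    qed
    then show ?thesis by (simp only:)
  qed
  finally show ?thesis unfolding odd_fps_def .
qed

lemma fps_of_int_odd_plus [simp]: "fps_of_int odd_plus_fps = odd_plus_fps"
  by (simp add: odd_plus_fps_def fps_of_int_prodinf)

text \<open>For \<open>a = b = 1\<close> the exponent is \<open>j^2\<close>, so this is the product
  for \<open>phi(q)\<close>; the next lemma is the one for \<open>phi(-q)\<close>.\<close>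

lemma theta_fps_1_1_pos: "theta_fps 1 1 1 = odd_plus_fps * odd_plus_fps * euler_fps 2"
proof -
  have "near_one (\<lambda>i. 1 + 1 * fps_X ^ (2 * i + 1) :: int fps)" by (rule near_one_fps_X_power) simp
  then show ?thesis
    using jacobi_triple_product[of 1 1 1] by (simp add: odd_plus_fps_def fps_prodinf_mult numeral_2_eq_2)
qed

lemma theta_fps_1_1_neg: "theta_fps (-1) 1 1 = odd_fps 1 * odd_fps 1 * euler_fps 2"
proof -
  have "theta_fps (-1) 1 1 = fps_prodinf (\<lambda>i. (1 - fps_X ^ (1 * (2 * i + 1))) * (1 - fps_X ^ (1 * (2 * i + 1)))) * euler_fps 2"
    using jacobi_triple_product[of "-1" 1 1] by (simp add: numeral_2_eq_2 flip: fps_const_neg)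
  then show ?thesis
    unfolding odd_fps_def by (simp only: fps_prodinf_mult[OF near_one_odd[of 1] near_one_odd[of 1]] zero_less_one)
qed

text \<open>The exponents \<open>4 * c * i + c\<close> and \<open>4 * c * i + 3 * c\<close> together
  run through the odd multiples of \<open>c\<close>.\<close>

lemma theta_fps_neg_triple:
  assumes "c > 0"
  shows "theta_fps (-1) c (3 * c) = odd_fps c * euler_fps (4 * c)"
proof -
  have "theta_fps (-1) c (3 * c) =
      fps_prodinf (\<lambda>i. (1 - fps_X ^ (4 * c * i + c)) * (1 - fps_X ^ (4 * c * i + 3 * c))) * euler_fps (4 * c)"
    using jacobi_triple_product[of "-1" c "3 * c"] assms by (simp flip: fps_const_neg)
  moreover have "odd_fps c = fps_prodinf (\<lambda>i. (1 - fps_X ^ (4 * c * i + c)) * (1 - fps_X ^ (4 * c * i + 3 * c)) :: int fps)"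
  proof -
    have *: "c * (2 * (i * 2 + 0) + 1) = 4 * c * i + c" "c * (2 * (i * 2 + 1) + 1) = 4 * c * i + 3 * c" for i
      by (simp_all add: algebra_simps)
    have "(\<Prod>r<2. g r) = g 0 * g 1" for g :: "nat \<Rightarrow> int fps" by (simp add: numeral_2_eq_2)
    then have "(\<Prod>r<2. 1 - fps_X ^ (c * (2 * (i * 2 + r) + 1))) =
        (1 - fps_X ^ (4 * c * i + c)) * (1 - fps_X ^ (4 * c * i + 3 * c) :: int fps)" for i
      by (simp only: *)
    moreover have "0 < (2 :: nat)" by simp
    note fps_prodinf_blocks[OF near_one_odd[OF assms, where 'a = int] this]
    ultimately show ?thesis unfolding odd_fps_def by (simp only:)
  qed
  ultimately show ?thesis by simp
qed

text \<open>Euler's pentagonal number theorem in \<open>q^c\<close>: the three families of exponents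
  are the multiples of \<open>c\<close> sorted modulo \<open>3 * c\<close>.\<close>

lemma theta_fps_neg_double:
  assumes "c > 0"
  shows "theta_fps (-1) c (2 * c) = euler_fps c"
proof -
  have near: "near_one (\<lambda>i. 1 - fps_X ^ (3 * c * i + c) :: int fps)" "near_one (\<lambda>i. 1 - fps_X ^ (3 * c * i + 2 * c) :: int fps)"
  proof -
    have *: "i < 3 * c * i + c" "i < 3 * c * i + 2 * c" for i
    proof -
      have "1 * i \<le> 3 * c * i" using assms by (intro mult_le_mono1) simp
      then show "i < 3 * c * i + c" "i < 3 * c * i + 2 * c" using assms by linarith+
    qed
    show "near_one (\<lambda>i. 1 - fps_X ^ (3 * c * i + c) :: int fps)"
      by (rule near_one_fps_X_power(1)) (rule *)
    show "near_one (\<lambda>i. 1 - fps_X ^ (3 * c * i + 2 * c) :: int fps)"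
      by (rule near_one_fps_X_power(1)) (rule *)
  qed
  have "theta_fps (-1) c (2 * c) =
      fps_prodinf (\<lambda>i. (1 - fps_X ^ (3 * c * i + c)) * (1 - fps_X ^ (3 * c * i + 2 * c))) * euler_fps (3 * c)"
    using jacobi_triple_product[of "-1" c "2 * c"] assms by (simp flip: fps_const_neg)
  also have "\<dots> = fps_prodinf (\<lambda>i. (1 - fps_X ^ (3 * c * i + c)) * (1 - fps_X ^ (3 * c * i + 2 * c)) * (1 - fps_X ^ (3 * c * Suc i)))"
    unfolding euler_fps_def using assms
    by (intro fps_prodinf_mult[symmetric] near_one_mult near near_one_euler) simp
  also have "\<dots> = euler_fps c"
  proof -
    have *: "c * Suc (i * 3 + 0) = 3 * c * i + c" "c * Suc (i * 3 + 1) = 3 * c * i + 2 * c"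
      "c * Suc (i * 3 + 2) = 3 * c * Suc i" for i
      by (simp_all add: algebra_simps)
    have "(\<Prod>r<3. g r) = g 0 * g 1 * g 2" for g :: "nat \<Rightarrow> int fps"
      by (simp add: numeral_3_eq_3 numeral_2_eq_2)
    then have "(\<Prod>r<3. 1 - fps_X ^ (c * Suc (i * 3 + r))) =
      (1 - fps_X ^ (3 * c * i + c)) * (1 - fps_X ^ (3 * c * i + 2 * c)) * (1 - fps_X ^ (3 * c * Suc i) :: int fps)" for i
      by (simp only: *)
    moreover have "0 < (3 :: nat)" by simp
    note fps_prodinf_blocks[OF near_one_euler[OF assms, where 'a = int] this]
    ultimately show ?thesis unfolding euler_fps_def by (simp only:)
  qed
  finally show ?thesis .
qed

text \<open>Even \<open>j\<close> cancel and odd \<open>j\<close> count twice. Of \<open>j\<close>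
  and \<open>-j\<close> exactly one has the form \<open>4 * i - 1\<close>, which gives another
  factor 2, and \<open>(4 * i - 1)^2 = 1 + theta_exp 8 24 i\<close>.\<close>

lemma theta_fps_1_1_diff: "theta_fps 1 1 1 - theta_fps (-1) 1 1 = 4 * (fps_X * theta_fps 1 8 24)"
proof (rule fps_ext)
  fix n
  have e1: "theta_exp 1 1 j = n \<longleftrightarrow> j * j = int n" for j n
    using int_theta_exp[of 1 1 j] by (simp add: algebra_simps) linarith
  have e8: "theta_exp 8 24 i = m \<longleftrightarrow> (4 * i - 1) * (4 * i - 1) = int (Suc m)" for i m
    using int_theta_exp[of 8 24 i] by (simp add: algebra_simps) linarith
  have fin: "finite {j. j * j = int m}" for m
  proof (rule finite_subset)
    show "{j. j * j = int m} \<subseteq> {-int m..int m}"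
    proof
      fix j assume "j \<in> {j. j * j = int m}"
      then have "theta_exp 1 1 j = m" using e1 by simp
      then show "j \<in> {-int m..int m}" using abs_le_theta_exp[of 1 1 j] by auto
    qed
  qed simp
  define A where "A = {j. j * j = int n \<and> j mod 4 = 3}"
  have "finite A" unfolding A_def by (rule finite_subset[OF _ fin[of n]]) auto
  have "fps_nth (theta_fps 1 1 1 - theta_fps (-1) 1 1) n = (\<Sum>j | j * j = int n. 1 - (-1) ^ nat \<bar>j\<bar>)"
    by (simp only: fps_sub_nth theta_fps_def fps_nth_Abs_fps e1 sum_subtractf power_one)
  also have "\<dots> = (\<Sum>j | j * j = int n. if odd j then 2 else 0)"
    by (intro sum.cong refl) (simp add: minus_one_power_iff even_nat_iff)
  also have "\<dots> = (\<Sum>j | j * j = int n \<and> odd j. 2)"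
    unfolding sum.inter_filter[OF fin, symmetric] by simp
  also have "{j. j * j = int n \<and> odd j} = A \<union> uminus ` A"
  proof (intro equalityI subsetI)
    fix j assume j: "j \<in> {j. j * j = int n \<and> odd j}"
    then have "odd j" by simp
    then have "j mod 4 = 3 \<or> (- j) mod 4 = 3" by presburger
    then show "j \<in> A \<union> uminus ` A"
    proof
      assume "(- j) mod 4 = 3"
      then have "- j \<in> A" using j by (simp add: A_def)
      then show ?thesis by (metis UnI2 image_eqI minus_minus)
    qed (use j in \<open>simp add: A_def\<close>)
  next
    fix j assume "j \<in> A \<union> uminus ` A"
    moreover have "odd j" if "j mod 4 = 3" for j :: int using that by presburger
    ultimately show "j \<in> {j. j * j = int n \<and> odd j}" by (auto simp: A_def)
  qed
  also have "(\<Sum>j\<in>A \<union> uminus ` A. 2 :: int) = 4 * int (card A)"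
  proof -
    have "\<not> (j mod 4 = 3 \<and> (- j) mod 4 = 3)" for j :: int by presburger
    then have "A \<inter> uminus ` A = {}" unfolding A_def by blast
    then have "card (A \<union> uminus ` A) = card A + card (uminus ` A)"
      using \<open>finite A\<close> by (intro card_Un_disjoint) auto
    also have "card (uminus ` A) = card A" by (rule card_image) (auto simp: inj_on_def)
    finally show ?thesis by simp
  qed
  also have "int (card A) = fps_nth (fps_X * theta_fps 1 8 24) n"
  proof (cases n)
    case 0
    have "j = 0" if "j \<in> A" for j using that 0 by (simp add: A_def)
    then have "A = {}" by (force simp: A_def)
    then show ?thesis using 0 by simp
  next
    case (Suc m)
    have "A = (\<lambda>i. 4 * i - 1) ` {i. theta_exp 8 24 i = m}"
    proof (intro equalityI subsetI)
      fix j assume "j \<in> A"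
      then have "j mod 4 = 3" by (simp add: A_def)
      then have "j = 4 * ((j + 1) div 4) - 1" by presburger
      with \<open>j \<in> A\<close> show "j \<in> (\<lambda>i. 4 * i - 1) ` {i. theta_exp 8 24 i = m}"
        unfolding A_def e8 Suc by auto
    next
      fix j assume "j \<in> (\<lambda>i. 4 * i - 1) ` {i. theta_exp 8 24 i = m}"
      then obtain i where "j = 4 * i - 1" "(4 * i - 1) * (4 * i - 1) = int n"
        unfolding e8 Suc by blast
      moreover have "(4 * i - 1) mod 4 = 3" by presburger
      ultimately show "j \<in> A" unfolding A_def by simp
    qed
    moreover have "inj_on (\<lambda>i::int. 4 * i - 1) B" for B by (auto simp: inj_on_def)
    ultimately have "card A = card {i. theta_exp 8 24 i = m}" using card_image by metis
    then show ?thesis by (simp add: Suc theta_fps_def)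
  qed
  finally show "fps_nth (theta_fps 1 1 1 - theta_fps (-1) 1 1) n = fps_nth (4 * (fps_X * theta_fps 1 8 24)) n"
    by (simp add: numeral_fps_const)
qed

section \<open>Generating functions of the two counting functions\<close>

definition bounded_partitions :: "nat \<Rightarrow> nat \<Rightarrow> nat multiset set" where
  "bounded_partitions m n = {M. set_mset M \<subseteq> {1..m} \<and> \<Sum>\<^sub># M = n}"

lemma size_le_sum_mset: "0 \<notin># M \<Longrightarrow> size M \<le> \<Sum>\<^sub># M" for M :: "nat multiset"
  by (induction M) auto

lemma member_le_sum_mset: "x \<in># M \<Longrightarrow> x \<le> \<Sum>\<^sub># M" for M :: "nat multiset"
  by (auto dest!: multi_member_split)

lemma finite_bounded_partitions: "finite (bounded_partitions m n)"
proof (rule finite_subset)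
  show "bounded_partitions m n \<subseteq> mset ` {xs. set xs \<subseteq> {1..m} \<and> length xs \<le> n}"
  proof
    fix M assume M: "M \<in> bounded_partitions m n"
    obtain xs where xs: "mset xs = M" using ex_mset by blast
    have "0 \<notin># M" using M unfolding bounded_partitions_def by auto
    then have "length xs \<le> n"
      using M size_le_sum_mset[of M] xs unfolding bounded_partitions_def by auto
    with M xs show "M \<in> mset ` {xs. set xs \<subseteq> {1..m} \<and> length xs \<le> n}"
      unfolding bounded_partitions_def by auto
  qed
qed (intro finite_imageI finite_lists_length_le, simp)

text \<open>Either the part \<open>Suc m\<close> is absent, or one copy of it can be
  removed.\<close>

lemma card_bounded_partitions_Suc:
  "card (bounded_partitions (Suc m) n) = card (bounded_partitions m n) +
    (if Suc m \<le> n then card (bounded_partitions (Suc m) (n - Suc m)) else 0)"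
proof -
  define B where "B = {M \<in> bounded_partitions (Suc m) n. Suc m \<in># M}"
  have split: "bounded_partitions (Suc m) n = bounded_partitions m n \<union> B"
    "bounded_partitions m n \<inter> B = {}"
    unfolding B_def bounded_partitions_def by (auto simp: atLeastAtMostSuc_conv)
  have "card B = (if Suc m \<le> n then card (bounded_partitions (Suc m) (n - Suc m)) else 0)"
  proof (cases "Suc m \<le> n")
    case True
    have "B = add_mset (Suc m) ` bounded_partitions (Suc m) (n - Suc m)"
    proof (intro equalityI subsetI)
      fix M assume "M \<in> B"
      then obtain A where "M = add_mset (Suc m) A" unfolding B_def by (auto dest: multi_member_split)
      with \<open>M \<in> B\<close> show "M \<in> add_mset (Suc m) ` bounded_partitions (Suc m) (n - Suc m)"
        unfolding B_def bounded_partitions_def by auto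
    qed (use True in \<open>auto simp: B_def bounded_partitions_def\<close>)
    then show ?thesis using True by (simp add: card_image inj_on_def)
  next
    case False
    then have "B = {}"
      unfolding B_def bounded_partitions_def using member_le_sum_mset by fastforce
    then show ?thesis using False by simp
  qed
  then show ?thesis
    unfolding split(1) using split(2) finite_bounded_partitions[of m n] finite_bounded_partitions[of "Suc m" n]
    by (subst card_Un_disjoint) (auto simp: B_def)
qed

lemma partition_number_eq:
  assumes "n \<le> m"
  shows "partition_number n = card (bounded_partitions m n)"
proof -
  have "set_mset M \<subseteq> {1..m}" if "0 \<notin># M" "\<Sum>\<^sub># M = n" for M :: "nat multiset"
  proof
    fix x assume x: "x \<in># M"
    then have "x \<noteq> 0" using that(1) by metis
    moreover have "x \<le> n" using member_le_sum_mset[OF x] that(2) by simp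
    ultimately show "x \<in> {1..m}" using assms by simp
  qed
  then have "{M :: nat multiset. 0 \<notin># M \<and> \<Sum>\<^sub># M = n} = bounded_partitions m n"
    unfolding bounded_partitions_def by auto
  then show ?thesis by (simp add: partition_number_def)
qed

definition partition_fps :: "int fps" where
  "partition_fps = Abs_fps (\<lambda>n. if even n then int (partition_number (n div 2)) else 0)"

text \<open>By the recursion above, multiplying by \<open>1 - fps_X ^ (2 * Suc m)\<close> lowers the
  bound on the parts from \<open>Suc m\<close> to \<open>m\<close>. So the bounded series
  \<open>G m\<close> is inverse to the partial product \<open>P m\<close>.\<close>

lemma partition_fps_mult_euler_fps: "partition_fps * euler_fps 2 = 1"
proof (rule fps_eq_if_cong_fps_X_powers)
  fix N
  define G :: "nat \<Rightarrow> int fps" where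
    "G m = Abs_fps (\<lambda>n. if even n then int (card (bounded_partitions m (n div 2))) else 0)" for m
  define P :: "nat \<Rightarrow> int fps" where "P m = (\<Prod>i<m. 1 - fps_X ^ (2 * Suc i))" for m
  have "G m * P m = 1" for m
  proof (induction m)
    case 0
    have "bounded_partitions 0 n = (if n = 0 then {{#}} else {})" for n
      unfolding bounded_partitions_def by auto
    then show ?case by (auto simp: G_def P_def fps_eq_iff elim!: evenE)
  next
    case (Suc m)
    have "G (Suc m) * (1 - fps_X ^ (2 * Suc m)) = G m"
    proof (rule fps_ext)
      fix n
      have "(n - 2 * Suc m) div 2 = n div 2 - Suc m" "2 * Suc m \<le> n \<longleftrightarrow> Suc m \<le> n div 2" "2 * Suc m \<le> n \<Longrightarrow> even (n - 2 * Suc m) \<longleftrightarrow> even n"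
        by auto
      then show "fps_nth (G (Suc m) * (1 - fps_X ^ (2 * Suc m))) n = fps_nth (G m) n"
        unfolding right_diff_distrib fps_sub_nth fps_X_power_mult_right_nth mult_1_right
        by (auto simp: G_def card_bounded_partitions_Suc not_less simp del: mult_Suc_right)
    qed
    moreover have "G (Suc m) * P (Suc m) = G (Suc m) * (1 - fps_X ^ (2 * Suc m)) * P m"
      unfolding P_def prod.lessThan_Suc by (simp only: mult_ac)
    ultimately show ?case using Suc by simp
  qed
  moreover have "fps_X ^ N dvd partition_fps - G N"
    unfolding fps_X_power_dvd_iff
    by (auto simp: partition_fps_def G_def partition_number_eq[of _ N])
  moreover have "fps_X ^ N dvd euler_fps 2 - P N"
    unfolding euler_fps_def P_def by (intro fps_prodinf_diff near_one_euler) simp_all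
  ultimately show "fps_X ^ N dvd partition_fps * euler_fps 2 - 1"
    using dvd_mult_diff_mult[of "fps_X ^ N" partition_fps "G N" "euler_fps 2" "P N"] by simp
qed

section \<open>The generating function of \<open>cphi2\<close> and the quotient by 4\<close>

lemma cphi2_gf_eq_fps_prodinf:
  "near_one (\<lambda>i. cphi2_factor (Suc i))" "cphi2_gf = fps_prodinf (\<lambda>i. cphi2_factor (Suc i))"
proof -
  have "fps_X ^ Suc i dvd cphi2_factor (Suc i) - 1" for i
  proof -
    obtain D where "cphi2_factor (Suc i) - 1 = fps_X ^ (2 * i + 1) * D"
      using cphi2_factor_minus_1 by blast
    moreover have "fps_X ^ Suc i dvd (fps_X ^ (2 * i + 1) :: real fps)"
      by (rule le_imp_power_dvd) simp
    ultimately show ?thesis by (metis dvd_mult2)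
  qed
  then show near: "near_one (\<lambda>i. cphi2_factor (Suc i))" by (simp add: near_one_def)
  \<comment> \<open>This excludes the clause of \<open>has_prod\<close> that assigns the value 0
    because of a vanishing factor.\<close>
  have nz: "cphi2_factor (Suc i) \<noteq> 0" for i
  proof
    assume 0: "cphi2_factor (Suc i) = 0"
    have "fps_X ^ Suc i dvd cphi2_factor (Suc i) - 1"
      using near unfolding near_one_def by blast
    then show False unfolding 0 fps_X_power_dvd_iff by auto
  qed
  have lim: "(\<lambda>n. \<Prod>i\<le>n. cphi2_factor (Suc i)) \<longlonglongrightarrow> cphi2_gf"
    using cphi2_has_prod nz unfolding has_prod_def raw_has_prod_def by auto
  show "cphi2_gf = fps_prodinf (\<lambda>i. cphi2_factor (Suc i))"
  proof (rule fps_prodinf_eqI[OF near])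
    fix N
    \<comment> \<open>Convergence makes each coefficient eventually constant; below \<open>N\<close>
      there are finitely many, so one threshold serves them all.\<close>
    have "\<forall>\<^sub>F n in sequentially. \<forall>m\<in>{..<N}. fps_nth (\<Prod>i\<le>n. cphi2_factor (Suc i)) m = fps_nth cphi2_gf m"
      using lim unfolding tendsto_fps_iff by (intro eventually_ball_finite) auto
    then obtain n0 where "\<And>n. n \<ge> n0 \<Longrightarrow> \<forall>m\<in>{..<N}. fps_nth (\<Prod>i\<le>n. cphi2_factor (Suc i)) m = fps_nth cphi2_gf m"
      unfolding eventually_sequentially by blast
    then have "\<forall>m<N. fps_nth (\<Prod>i<Suc (n0 + N). cphi2_factor (Suc i)) m = fps_nth cphi2_gf m"
      unfolding lessThan_Suc_atMost by auto
    then have "fps_X ^ N dvd cphi2_gf - (\<Prod>i<Suc (n0 + N). cphi2_factor (Suc i))"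
      unfolding fps_X_power_dvd_iff by (simp only: fps_sub_nth) simp
    then show "\<exists>n\<ge>N. fps_X ^ N dvd cphi2_gf - (\<Prod>i<n. cphi2_factor (Suc i))"
      by (intro exI[of _ "Suc (n0 + N)"]) simp
  qed
qed

lemma cphi2_gf_mult_products: "cphi2_gf * (odd_fps 1 ^ 4 * euler_fps 4) = odd_fps 2"
proof -
  define u v :: "nat \<Rightarrow> real fps"
    where "u i = 1 - fps_X ^ (1 * (2 * i + 1))" and "v i = 1 - fps_X ^ (4 * Suc i)" for i
  have near: "near_one u" "near_one v"
    unfolding u_def v_def by (intro near_one_odd near_one_euler; simp)+
  have uv: "odd_fps 1 = fps_prodinf u" "euler_fps 4 = fps_prodinf v"
    by (simp_all only: u_def[abs_def] v_def[abs_def] odd_fps_def euler_fps_def)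
  have factor: "cphi2_factor (Suc i) * (u i * u i * (u i * u i) * v i) = 1 - fps_X ^ (2 * (2 * i + 1))" for i
  proof -
    define B where "B = u i ^ 4 * v i"
    have "fps_nth B 0 = 1" by (simp add: B_def u_def v_def fps_mult_nth_0 fps_nth_power_0)
    then have "inverse B * B = 1" by (intro inverse_mult_eq_1) simp
    have "4 * Suc i - 2 = 2 * (2 * i + 1)" "2 * Suc i - 1 = 1 * (2 * i + 1)" by simp_all
    then have "cphi2_factor (Suc i) = (1 - fps_X ^ (2 * (2 * i + 1))) / B"
      unfolding cphi2_factor_def B_def u_def v_def by (simp only:)
    also have "\<dots> = (1 - fps_X ^ (2 * (2 * i + 1))) * inverse B"
      using \<open>fps_nth B 0 = 1\<close> by (intro fps_divide_unit) simp
    finally have "cphi2_factor (Suc i) * B = 1 - fps_X ^ (2 * (2 * i + 1))"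
      using \<open>inverse B * B = 1\<close> by (simp add: mult.assoc)
    then show ?thesis by (simp add: B_def power4_eq_xxxx mult.assoc)
  qed
  have near4: "near_one (\<lambda>i. u i * u i * (u i * u i) * v i)" by (intro near_one_mult near)
  have "odd_fps 1 ^ 4 * euler_fps 4 = fps_prodinf (\<lambda>i. u i * u i * (u i * u i) * v i)"
    unfolding uv by (simp add: fps_prodinf_mult near_one_mult near power4_eq_xxxx mult.assoc)
  then have "cphi2_gf * (odd_fps 1 ^ 4 * euler_fps 4) =
      fps_prodinf (\<lambda>i. cphi2_factor (Suc i) * (u i * u i * (u i * u i) * v i))"
    unfolding cphi2_gf_eq_fps_prodinf(2) using fps_prodinf_mult[OF cphi2_gf_eq_fps_prodinf(1) near4] by simp
  also have "\<dots> = odd_fps 2" unfolding factor odd_fps_def ..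
  finally show ?thesis .
qed

lemma cphi2_gf_mult_euler_fps: "cphi2_gf * (euler_fps 1 * euler_fps 1) = fps_of_int (theta_fps 1 1 1)"
proof -
  define g O' Q E2 E4 :: "real fps" where "g = cphi2_gf" and "O' = odd_fps 1" and "Q = odd_plus_fps"
    and "E2 = euler_fps 2" and "E4 = euler_fps 4"
  have E1: "euler_fps 1 = O' * E2"
    using euler_fps_split[of 1] unfolding O'_def E2_def by simp
  have E2: "E2 = Q * O' * E4"
    using euler_fps_split[of 2] unfolding O'_def E2_def E4_def Q_def odd_plus_fps_mult_odd_fps by simp
  have g: "g * (O' ^ 4 * E4) = Q * O'"
    using cphi2_gf_mult_products unfolding O'_def E4_def Q_def g_def odd_plus_fps_mult_odd_fps .
  \<comment> \<open>With the extra \<open>O'\<close>, replacing one \<open>E2\<close> by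
    \<open>Q * O' * E4\<close> completes the denominator \<open>O' ^ 4 * E4\<close> of
    \<open>g\<close>.\<close>
  have "O' * (g * (euler_fps 1 * euler_fps 1)) = g * (O' ^ 4 * E4) * Q * E2"
    unfolding E1 by (subst (1) E2) (simp add: power4_eq_xxxx mult_ac)
  also have "\<dots> = O' * (Q * Q * E2)" unfolding g by (simp add: mult_ac)
  finally have "g * (euler_fps 1 * euler_fps 1) = Q * Q * E2"
    by (simp add: O'_def odd_fps_nonzero)
  then show ?thesis unfolding g_def Q_def E2_def theta_fps_1_1_pos by simp
qed

text \<open>The quotient is specified by its product equation to keep integer coefficients; a
  solution exists because the Euler product is invertible.\<close>

definition cphi2_quarter :: "int fps" where
  "cphi2_quarter = (SOME f. f * (euler_fps 1 * euler_fps 1) = fps_X * theta_fps 1 8 24)"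

lemma cphi2_quarter_mult: "cphi2_quarter * (euler_fps 1 * euler_fps 1) = fps_X * theta_fps 1 8 24"
proof -
  obtain J :: "int fps" where "euler_fps 1 * J = 1"
    using fps_unit_if_nth_0[of "euler_fps 1"] fps_prodinf_nth_0 unfolding euler_fps_def by metis
  moreover have "fps_X * theta_fps 1 8 24 * (J * J) * (euler_fps 1 * euler_fps 1) =
      fps_X * theta_fps 1 8 24 * ((euler_fps 1 * J) * (euler_fps 1 * J))"
    by (simp only: mult_ac)
  ultimately have "fps_X * theta_fps 1 8 24 * (J * J) * (euler_fps 1 * euler_fps 1) = fps_X * theta_fps 1 8 24"
    by simp
  then show ?thesis unfolding cphi2_quarter_def by (rule someI)
qed

text \<open>Multiplied by \<open>euler_fps 1\<close> squared, the two generating functions become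
  \<open>phi(q)\<close> and \<open>phi(-q)\<close>; their difference is known, and the nonzero
  square cancels.\<close>

lemma cphi2_bar_eq: "cphi2_bar n = 4 * real_of_int (fps_nth cphi2_quarter n)"
proof -
  define E1 :: "int fps" where "E1 = euler_fps 1"
  have "E1 = odd_fps 1 * euler_fps 2" using euler_fps_split[of 1] by (simp add: E1_def)
  then have "partition_fps * (E1 * E1) = partition_fps * euler_fps 2 * theta_fps (-1) 1 1"
    unfolding theta_fps_1_1_neg by (simp only: mult_ac)
  then have P: "partition_fps * (E1 * E1) = theta_fps (-1) 1 1"
    unfolding partition_fps_mult_euler_fps by simp
  have "theta_fps 1 1 1 - theta_fps (-1) 1 1 = 4 * cphi2_quarter * (E1 * E1)"
    unfolding theta_fps_1_1_diff E1_def mult.assoc[of 4] cphi2_quarter_mult ..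
  then have "theta_fps 1 1 1 = (partition_fps + 4 * cphi2_quarter) * (E1 * E1)"
    unfolding distrib_right P by (metis add.commute diff_add_cancel)
  then have "cphi2_gf * (euler_fps 1 * euler_fps 1) =
      fps_of_int (partition_fps + 4 * cphi2_quarter) * (euler_fps 1 * euler_fps 1)"
    unfolding cphi2_gf_mult_euler_fps by (simp add: E1_def)
  then have gf: "cphi2_gf = fps_of_int (partition_fps + 4 * cphi2_quarter)"
    by (simp add: euler_fps_nonzero del: fps_of_int_simps)
  show ?thesis
    unfolding cphi2_bar_def cphi2_def gf fps_of_int_nth by (simp add: partition_fps_def numeral_fps_const)
qed

section \<open>Reduction modulo 2\<close>

lemma euler_fps_square_bit: "euler_fps k * euler_fps k = (euler_fps (2 * k) :: bit fps)" if "k > 0"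
proof -
  have "(1 - fps_X ^ (k * Suc i)) * (1 - fps_X ^ (k * Suc i)) = (1 - fps_X ^ (2 * k * Suc i) :: bit fps)" for i
  proof -
    have "2 * k * Suc i = k * Suc i + k * Suc i" by simp
    then have "fps_X ^ (2 * k * Suc i) = fps_X ^ (k * Suc i) * (fps_X ^ (k * Suc i) :: bit fps)"
      by (simp only: power_add)
    moreover have "(1 - y) * (1 - y) = 1 - y * y" for y :: "bit fps"
    proof -
      have "y + y = 0" by (simp add: fps_eq_iff)
      have "(1 - y) * (1 - y) = 1 - y * y + (y * y + y * y) - (y + y)" by (simp add: algebra_simps)
      moreover have "z + z = 0" for z :: "bit fps" by (simp add: fps_eq_iff)
      ultimately show ?thesis by simp
    qed
    ultimately show ?thesis by simp
  qed
  then show ?thesis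
    unfolding euler_fps_def fps_prodinf_mult[OF near_one_euler[OF that] near_one_euler[OF that], symmetric]
    by (simp only:)
qed

text \<open>Modulo 2 the signs disappear, so the product formulas for \<open>s = -1\<close> apply to
  \<open>s = 1\<close>.\<close>

lemma fps_of_int_theta_bit: "fps_of_int (theta_fps 1 a b) = (fps_of_int (theta_fps (-1) a b) :: bit fps)"
proof -
  have "(-1 :: bit) = 1" by simp
  then show ?thesis by (simp add: fps_eq_iff theta_fps_def of_int_sum)
qed

text \<open>Every product here is a power of \<open>e\<close>: \<open>odd_fps 8\<close> is
  \<open>e^(-8)\<close> and \<open>odd_fps 2\<close> is \<open>e^(-2)\<close>, so both sides equal
  \<open>fps_X * e ^ 22\<close>.\<close>

lemma cphi2_quarter_bit:
  "fps_of_int cphi2_quarter = (fps_X * fps_of_int (theta_fps 1 2 6 * theta_fps 1 16 32) :: bit fps)"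
proof -
  define e a :: "bit fps" where "e = euler_fps 1" and "a = fps_of_int cphi2_quarter"
  have e2: "euler_fps 2 = e ^ 2" using euler_fps_square_bit[of 1] by (simp add: e_def power2_eq_square)
  have e4: "euler_fps 4 = e ^ 4" using euler_fps_square_bit[of 2] by (simp add: e2 flip: power_add)
  have e8: "euler_fps 8 = e ^ 8" using euler_fps_square_bit[of 4] by (simp add: e4 flip: power_add)
  have e16: "euler_fps 16 = e ^ 16" using euler_fps_square_bit[of 8] by (simp add: e8 flip: power_add)
  have e32: "euler_fps 32 = e ^ 32" using euler_fps_square_bit[of 16] by (simp add: e16 flip: power_add)
  have "euler_fps 2 = odd_fps 2 * (euler_fps 4 :: bit fps)" using euler_fps_split[of 2] by simp
  then have o2: "odd_fps 2 * e ^ 4 = e ^ 2" unfolding e2 e4 by (rule sym)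
  have "euler_fps 8 = odd_fps 8 * (euler_fps 16 :: bit fps)" using euler_fps_split[of 8] by simp
  then have o8: "odd_fps 8 * e ^ 16 = e ^ 8" unfolding e8 e16 by (rule sym)
  have "theta_fps (-1) 8 24 = odd_fps 8 * euler_fps 32" "theta_fps (-1) 2 6 = odd_fps 2 * euler_fps 8"
    using theta_fps_neg_triple[of 8] theta_fps_neg_triple[of 2] by simp_all
  moreover have "theta_fps (-1) 16 32 = euler_fps 16" using theta_fps_neg_double[of 16] by simp
  ultimately have t: "fps_of_int (theta_fps 1 8 24) = odd_fps 8 * e ^ 32"
    "fps_of_int (theta_fps 1 2 6) = odd_fps 2 * e ^ 8" "fps_of_int (theta_fps 1 16 32) = e ^ 16"
    unfolding fps_of_int_theta_bit by (simp_all add: e8 e16 e32)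
  have "fps_of_int (cphi2_quarter * (euler_fps 1 * euler_fps 1)) = (fps_of_int (fps_X * theta_fps 1 8 24) :: bit fps)"
    unfolding cphi2_quarter_mult ..
  then have a: "a * e ^ 2 = fps_X * (odd_fps 8 * e ^ 32)"
    by (simp add: a_def e_def t power2_eq_square)
  \<comment> \<open>The factor \<open>e ^ 18\<close> supplies the \<open>e ^ 2\<close> and
    \<open>e ^ 16\<close> needed to use \<open>a\<close> and \<open>o8\<close> without negative
    powers.\<close>
  have "a * e ^ 18 = a * e ^ 2 * e ^ 16" by (simp add: mult.assoc flip: power_add)
  also have "\<dots> = fps_X * e ^ 32 * (odd_fps 8 * e ^ 16)" unfolding a by (simp only: mult_ac)
  also have "\<dots> = fps_X * e ^ 38 * e ^ 2" unfolding o8 by (simp add: mult.assoc flip: power_add)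
  also have "\<dots> = fps_X * odd_fps 2 * (e ^ 38 * e ^ 4)" unfolding o2[symmetric] by (simp only: mult_ac)
  also have "e ^ 38 * e ^ 4 = e ^ 8 * e ^ 16 * e ^ 18" by (simp flip: power_add)
  also have "fps_X * odd_fps 2 * (e ^ 8 * e ^ 16 * e ^ 18) = fps_X * (odd_fps 2 * e ^ 8 * e ^ 16) * e ^ 18"
    by (simp only: mult_ac)
  finally have "a = fps_X * (odd_fps 2 * e ^ 8 * e ^ 16)"
    by (simp add: e_def euler_fps_nonzero)
  then show ?thesis by (simp add: a_def t)
qed

lemma cphi2_quarter_odd_imp_form:
  assumes "odd (fps_nth cphi2_quarter N)"
  shows "\<exists>x y :: int. 12 * int N = 3 * x\<^sup>2 + 8 * y\<^sup>2 + 1"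
proof -
  have "of_int (fps_nth cphi2_quarter N) \<noteq> (0 :: bit)" using assms by (auto elim!: oddE)
  then have *: "fps_nth (fps_X * fps_of_int (theta_fps 1 2 6 * theta_fps 1 16 32) :: bit fps) N \<noteq> 0"
    unfolding cphi2_quarter_bit[symmetric] by simp
  then obtain M where M: "N = Suc M" by (cases N) auto
  have "fps_nth (theta_fps 1 2 6 * theta_fps 1 16 32) M \<noteq> 0"
  proof
    assume "fps_nth (theta_fps 1 2 6 * theta_fps 1 16 32) M = 0"
    then show False using * unfolding M by (simp del: fps_of_int_simps)
  qed
  then obtain i where i: "i \<in> {0..M}" "fps_nth (theta_fps 1 2 6) i * fps_nth (theta_fps 1 16 32) (M - i) \<noteq> 0"
    unfolding fps_mult_nth by (rule sum.not_neutral_contains_not_neutral)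
  then have "{j. theta_exp 2 6 j = i} \<noteq> {}" "{j. theta_exp 16 32 j = M - i} \<noteq> {}"
    unfolding theta_fps_def by (auto simp: card_gt_0_iff)
  then obtain j k where "theta_exp 2 6 j = i" "theta_exp 16 32 k = M - i" by blast
  then have "int N = int (theta_exp 2 6 j) + int (theta_exp 16 32 k) + 1" using i(1) M by simp
  moreover have "int (theta_exp 2 6 j) = 4 * (j * j) - 2 * j"
    using int_theta_exp[of 2 6 j] by (simp add: algebra_simps)
  moreover have "int (theta_exp 16 32 k) = 24 * (k * k) - 8 * k"
    using int_theta_exp[of 16 32 k] by (simp add: algebra_simps)
  \<comment> \<open>Multiplying by 12 completes both squares; the constant is
    \<open>12 - 3 - 8 = 1\<close>.\<close>
  ultimately have "12 * int N = 3 * (4 * j - 1)\<^sup>2 + 8 * (6 * k - 1)\<^sup>2 + 1"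
    by (simp add: power2_eq_square algebra_simps)
  then show ?thesis by blast
qed

theorem theorem2:
  fixes r t :: int
  assumes "t \<ge> 1"
  shows "infinite {N :: nat. [int N = r] (mod t) \<and>
           (\<exists>k :: int. cphi2_bar N / 4 = of_int k \<and> even k)}"
proof (rule infinite_super)
  show "infinite {N :: nat. [int N = r] (mod t) \<and> (\<nexists>x y :: int. 12 * int N = 3 * x\<^sup>2 + 8 * y\<^sup>2 + 1)}"
    using assms by (rule infinite_not_form)
  \<comment> \<open>By contraposition the coefficient of \<open>cphi2_quarter\<close> at such an
    \<open>N\<close> is even, and it serves as \<open>k\<close>.\<close>
  show "{N :: nat. [int N = r] (mod t) \<and> (\<nexists>x y :: int. 12 * int N = 3 * x\<^sup>2 + 8 * y\<^sup>2 + 1)} \<subseteq>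
      {N. [int N = r] (mod t) \<and> (\<exists>k :: int. cphi2_bar N / 4 = of_int k \<and> even k)}"
    using cphi2_quarter_odd_imp_form by (auto simp: cphi2_bar_eq)
qed

end
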